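(* Let $L$ be a Fomin lattice (with value set $V$, differential degree $r$ and weighting $w$) such that: (i) $L$ has a minimum element $\hat{0}$; (ii) $L$ is distributive, so $L$ is isomorphic to the lattice of finite order ideals of its poset $P$ of join-irreducible elements ("points"), and $w$ is given by a function $w:P\to V$ with $w(x\lessdot y)=w(y\setminus x)$; (iii) $P$ is unique-cover-modular; (iv) the weighting is positive: $V=\mathbb{Z}$, every value of $w$ is a positive integer, and $r>0$; (v) $L$ is not isomorphic to a cartesian product of two nontrivial lattices (equivalently, $P$ cannot be written as a disjoint union of two nonempty subposets $P_1\sqcup P_2$ with no element of $P_1$ comparable to an element of $P_2$). Then one of the following holds: (Y) $P$ is isomorphic to the quadrant $\{(x,y)\in\mathbb{Z}^2 : x\ge 0,\ y\ge 0\}$ with componentwise order (so $L$ is isomorphic to Young's lattice of partitions), and $w(p)=r$ for every point $p$; (SY) $P$ is isomorphic to the octant $\{(x,y)\in\mathbb{Z}^2 : x\ge 0,\ 0\le y\le x\}$ with componentwise order (so $L$ is isomorphic to the shifted Young's lattice of strict partitions), and $w((x,y))=r$ if $x=y$ and $w((x,y))=2r$ if $x\neq y$ (i.e. $r$ times the canonical weighting with values $1$ and $2$); ($\mathbb{Y}_k$) for some integer $k\ge 1$, $P$ is isomorphic to the strip $\{(x,y)\in\mathbb{Z}^2 : x\ge 0,\ 0\le y<k\}$ with componentwise order (so $L$ is isomorphic to the lattice of partitions with at most $k$ parts), and $w((x,y))=\frac{r}{k}(k+x-y)$.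
   Context: A Fomin lattice consists of: a lattice $L$ that is modular, locally finite, and in which every element has finitely many upper covers and finitely many lower covers; a module $V$ (the set of values) over a unital ring; an element $r\in V$ (the differential degree); and a function $w$ assigning to every covering $x\lessdot y$ of $L$ a value $w(x\lessdot y)\in V$, such that (a) for all $x\in L$, $\sum_{y\lessdot x} w(y\lessdot x)+r=\sum_{x\lessdot z}w(x\lessdot z)$, and (b) $w$ is projective-constant: whenever $x\vee y$ covers both $x$ and $y$ and $x\wedge y$ is covered by both $x$ and $y$, then $w(x\wedge y\lessdot x)=w(y\lessdot x\vee y)$ and $w(x\wedge y\lessdot y)=w(x\lessdot x\vee y)$. For a distributive such $L$ with $\hat 0$, each covering $x\lessdot y$ of ideals differs by exactly one point, and projective-constancy means $w(x\lessdot y)$ depends only on that point. A poset $P$ is unique-cover-modular if whenever two distinct elements $x,y\in P$ either both cover a common element or are both covered by a common element, then there is a unique element covered by both $x$ and $y$ and a unique element covering both $x$ and $y$. *)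

theory Defs
  imports Complex_Main "HOL-Library.Product_Order"
begin

section \<open>Coverings and isomorphisms of posets\<close>

text \<open>Subposets are subsets of an ordered type with the induced order, and a covering is
  always taken relative to the subset at hand.\<close>

definition covers_in :: "'a::order set \<Rightarrow> 'a \<Rightarrow> 'a \<Rightarrow> bool" where
  "covers_in P x y \<longleftrightarrow> x \<in> P \<and> y \<in> P \<and> x < y \<and> \<not> (\<exists>z\<in>P. x < z \<and> z < y)"

abbreviation covered_by :: "'a::order \<Rightarrow> 'a \<Rightarrow> bool" (infix \<open>\<lessdot>\<close> 50) where
  "x \<lessdot> y \<equiv> covers_in UNIV x y"

definition order_iso ::
  "('a \<Rightarrow> 'b) \<Rightarrow> 'a set \<Rightarrow> ('a \<Rightarrow> 'a \<Rightarrow> bool) \<Rightarrow> 'b set \<Rightarrow> ('b \<Rightarrow> 'b \<Rightarrow> bool) \<Rightarrow> bool" where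
  "order_iso f A leA B leB \<longleftrightarrow>
     bij_betw f A B \<and> (\<forall>x\<in>A. \<forall>y\<in>A. leA x y \<longleftrightarrow> leB (f x) (f y))"

definition unique_cover_modular :: "'a::order set \<Rightarrow> bool" where
  "unique_cover_modular P \<longleftrightarrow>
     (\<forall>x\<in>P. \<forall>y\<in>P. x \<noteq> y \<longrightarrow>
        (\<exists>z. covers_in P z x \<and> covers_in P z y) \<or> (\<exists>z. covers_in P x z \<and> covers_in P y z) \<longrightarrow>
        (\<exists>!z. covers_in P z x \<and> covers_in P z y) \<and> (\<exists>!z. covers_in P x z \<and> covers_in P y z))"


section \<open>Fomin lattices\<close>

text \<open>The lattice is the whole type \<open>'a\<close>. The value module enters only through its additive
  group, and every abelian group is a module over the integers, so \<open>'v\<close> is any abelian group.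
  The weighting \<open>w x y\<close> is meaningful only when \<open>x \<lessdot> y\<close>; nothing is said about other pairs.\<close>

locale fomin_lattice =
  fixes r :: "'v::ab_group_add"
    and w :: "'a::lattice \<Rightarrow> 'a \<Rightarrow> 'v"
  assumes modular: "\<And>x y z :: 'a. x \<le> z \<Longrightarrow> sup x (inf y z) = inf (sup x y) z"
    and locally_finite: "\<And>x y :: 'a. finite {x..y}"
    and finite_upper_covers: "\<And>x :: 'a. finite {z. x \<lessdot> z}"
    and finite_lower_covers: "\<And>x :: 'a. finite {y. y \<lessdot> x}"
    and differential: "\<And>x. (\<Sum>y | y \<lessdot> x. w y x) + r = (\<Sum>z | x \<lessdot> z. w x z)"
    and projective_constant:
      "\<And>x y. x \<lessdot> sup x y \<Longrightarrow> y \<lessdot> sup x y \<Longrightarrow> inf x y \<lessdot> x \<Longrightarrow> inf x y \<lessdot> y \<Longrightarrow>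
         w (inf x y) x = w y (sup x y) \<and> w (inf x y) y = w x (sup x y)"


section \<open>Points\<close>

definition points :: "'a::bounded_lattice_bot set" where
  "points = {p. p \<noteq> bot \<and> (\<forall>x y. p = sup x y \<longrightarrow> p = x \<or> p = y)}"

text \<open>The order ideal of points that represents \<open>x\<close>.\<close>

definition points_below :: "'a::bounded_lattice_bot \<Rightarrow> 'a set" where
  "points_below x = {p \<in> points. p \<le> x}"

text \<open>The weighting \<open>w\<close> of coverings is given by the function \<open>wP\<close> on points, that is,
  \<open>w(x \<lessdot> y) = wP(y - x)\<close>. Every point \<open>p\<close> occurs in this way, for the covering of \<open>p\<close> over its
  unique lower cover, so the values of \<open>wP\<close> on points are determined by \<open>w\<close>.\<close>

definition given_by_points :: "('a::bounded_lattice_bot \<Rightarrow> 'a \<Rightarrow> 'v) \<Rightarrow> ('a \<Rightarrow> 'v) \<Rightarrow> bool" where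
  "given_by_points w wP \<longleftrightarrow>
     (\<forall>x y. x \<lessdot> y \<longrightarrow> (\<exists>p. points_below y - points_below x = {p} \<and> w x y = wP p))"


section \<open>Decomposition as a product\<close>

definition lattice_on :: "'a set \<Rightarrow> ('a \<Rightarrow> 'a \<Rightarrow> bool) \<Rightarrow> bool" where
  "lattice_on A le \<longleftrightarrow>
     reflp_on A le \<and> transp_on A le \<and> antisymp_on A le \<and>
     (\<forall>x\<in>A. \<forall>y\<in>A. \<exists>s\<in>A. le x s \<and> le y s \<and> (\<forall>u\<in>A. le x u \<and> le y u \<longrightarrow> le s u)) \<and>
     (\<forall>x\<in>A. \<forall>y\<in>A. \<exists>i\<in>A. le i x \<and> le i y \<and> (\<forall>l\<in>A. le l x \<and> le l y \<longrightarrow> le l i))"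

definition nontrivial :: "'a set \<Rightarrow> bool" where
  "nontrivial A \<longleftrightarrow> (\<exists>x\<in>A. \<exists>y\<in>A. x \<noteq> y)"

text \<open>The two factors are arbitrary lattices whose elements are taken from the type \<open>'a\<close>. This is
  no restriction, because each factor of a product isomorphic to \<open>'a\<close> embeds in \<open>'a\<close>; see the
  lemma below.\<close>

definition product_decomposable :: "'a::lattice itself \<Rightarrow> bool" where
  "product_decomposable _ \<longleftrightarrow>
     (\<exists>(A :: 'a set) leA (B :: 'a set) leB f.
        lattice_on A leA \<and> nontrivial A \<and> lattice_on B leB \<and> nontrivial B \<and>
        order_iso f (UNIV :: 'a set) (\<le>)
          (A \<times> B) (\<lambda>(a, b) (a', b'). leA a a' \<and> leB b b'))"

lemma product_decomposableI:
  fixes f :: "'a::lattice \<Rightarrow> 'b::lattice \<times> 'c::lattice"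
  assumes iso: "order_iso f UNIV (\<le>) UNIV (\<le>)"
    and nb: "nontrivial (UNIV :: 'b set)" and nc: "nontrivial (UNIV :: 'c set)"
  shows "product_decomposable TYPE('a)"
proof -
  have bij: "bij f" and mono: "\<And>x y. x \<le> y \<longleftrightarrow> f x \<le> f y"
    using iso by (auto simp: order_iso_def)
  define g where "g = inv f"
  have fg [simp]: "f (g p) = p" for p
    using bij by (simp add: g_def bij_is_surj surj_f_inv_f)
  have g_inj: "g p = g q \<longleftrightarrow> p = q" for p q
    by (metis fg)
  obtain b0 :: 'b and c0 :: 'c where True by blast
  define A where "A = range (\<lambda>b. g (b, c0))"
  define B where "B = range (\<lambda>c. g (b0, c))"
  define leA where "leA = (\<lambda>x y. fst (f x) \<le> fst (f y))"
  define leB where "leB = (\<lambda>x y. snd (f x) \<le> snd (f y))"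
  define h where "h = (\<lambda>x. (g (fst (f x), c0), g (b0, snd (f x))))"
  have "lattice_on A leA"
    unfolding lattice_on_def A_def leA_def
    by (simp add: reflp_on_def transp_on_def antisymp_on_def g_inj)
      (meson order_trans order_antisym sup_ge1 sup_ge2 sup_least inf_le1 inf_le2 inf_greatest)
  moreover have "lattice_on B leB"
    unfolding lattice_on_def B_def leB_def
    by (simp add: reflp_on_def transp_on_def antisymp_on_def g_inj)
      (meson order_trans order_antisym sup_ge1 sup_ge2 sup_least inf_le1 inf_le2 inf_greatest)
  moreover have "nontrivial A" "nontrivial B"
    using nb nc by (auto simp: nontrivial_def A_def B_def g_inj)
  moreover have "bij_betw h UNIV (A \<times> B)"
    unfolding bij_betw_def
  proof
    show "inj h"
    proof (rule injI)
      fix x y assume "h x = h y"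
      then have "f x = f y"
        by (simp add: h_def g_inj prod_eq_iff)
      then show "x = y"
        using bij by (simp add: bij_is_inj inj_eq)
    qed
    show "range h = A \<times> B"
    proof (intro equalityI subsetI)
      fix q assume "q \<in> A \<times> B"
      then obtain b c where "q = (g (b, c0), g (b0, c))"
        by (auto simp: A_def B_def)
      then have "q = h (g (b, c))"
        by (simp add: h_def)
      then show "q \<in> range h" by blast
    next
      fix q assume "q \<in> range h"
      then show "q \<in> A \<times> B"
        by (auto simp: h_def A_def B_def)
    qed
  qed
  moreover have "x \<le> y \<longleftrightarrow> leA (fst (h x)) (fst (h y)) \<and> leB (snd (h x)) (snd (h y))" for x y
    by (simp add: mono less_eq_prod_def h_def leA_def leB_def)
  ultimately have "lattice_on A leA \<and> nontrivial A \<and> lattice_on B leB \<and> nontrivial B \<and>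
      order_iso h UNIV (\<le>) (A \<times> B) (\<lambda>(a, b) (a', b'). leA a a' \<and> leB b b')"
    by (simp add: order_iso_def case_prod_beta)
  then show ?thesis
    unfolding product_decomposable_def by blast
qed


section \<open>The standard examples\<close>

text \<open>The order on \<^typ>\<open>int \<times> int\<close> is the componentwise one.\<close>

definition quadrant :: "(int \<times> int) set" where
  "quadrant = {(x, y). 0 \<le> x \<and> 0 \<le> y}"

definition octant :: "(int \<times> int) set" where
  "octant = {(x, y). 0 \<le> x \<and> 0 \<le> y \<and> y \<le> x}"

definition strip :: "nat \<Rightarrow> (int \<times> int) set" where
  "strip k = {(x, y). 0 \<le> x \<and> 0 \<le> y \<and> y < int k}"

text \<open>A partition is the weakly decreasing sequence of its parts, padded with zeros. The order is
  the pointwise one on \<^typ>\<open>nat \<Rightarrow> nat\<close>, that is, inclusion of Young diagrams.\<close>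

definition partitions :: "(nat \<Rightarrow> nat) set" where
  "partitions = {f. antimono f \<and> finite {i. f i \<noteq> 0}}"

definition strict_partitions :: "(nat \<Rightarrow> nat) set" where
  "strict_partitions = {f \<in> partitions. \<forall>i j. i < j \<longrightarrow> f i \<noteq> 0 \<longrightarrow> f j < f i}"

definition partitions_at_most :: "nat \<Rightarrow> (nat \<Rightarrow> nat) set" where
  "partitions_at_most k = {f \<in> partitions. card {i. f i \<noteq> 0} \<le> k}"

end

theory Submission
  imports Defs
begin

text \<open>Through \<open>x \<mapsto> points_below x\<close> the lattice becomes the
  lattice of finite order ideals of the poset \<open>P\<close> of points, with a weight on
  points. Comparing the differential equation at an ideal and at the ideal enlarged by one point
  \<open>p\<close> gives, for every finite set \<open>A\<close> of points of the rank of
  \<open>p\<close>, an equation between \<open>2 w(p)\<close>, the weights of those lower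
  covers of \<open>p\<close> that no element of \<open>A\<close> covers and the weights of
  those upper covers of \<open>p\<close> that have all their lower covers in \<open>A \<union>
  {p}\<close>. Varying \<open>A\<close> and using positivity, every point has at most two upper
  and at most two lower covers, the top of a square weighs as much as its bottom, and \<open>2
  w(p)\<close> is the weight of the lower covers of \<open>p\<close> plus the weight of the
  points that cover \<open>p\<close> only. Hence each rank of \<open>P\<close> is a path, and
  it determines the next rank as soon as it has two elements. What remains free is the length of
  the initial chain and the weights of the two points at which it branches. A chain that never
  branches is the strip with \<open>k = 1\<close>, branching at the minimum gives the quadrant
  or a strip with \<open>k \<ge> 2\<close>, branching one step later gives the octant. If the
  chain branches after \<open>m \<ge> 2\<close> steps, the weights force \<open>m =
  5\<close>, where they begin like the labels \<open>1, \<dots>, 6\<close> with branches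
  \<open>3\<close> and \<open>4, 2\<close> of the affine Dynkin diagram of type
  \<open>E\<^sub>8\<close>, and continuing a few ranks further leads to a
  contradiction.\<close>

section \<open>Local structure of the poset of points\<close>

definition fin_ideal :: "'a::order set \<Rightarrow> 'a set \<Rightarrow> bool" where
  "fin_ideal P I \<longleftrightarrow> finite I \<and> I \<subseteq> P \<and> (\<forall>p\<in>I. \<forall>q\<in>P. q \<le> p \<longrightarrow> q \<in> I)"

text \<open>For an ideal these index its lower covers: exactly these points can be removed.\<close>

definition max_elts :: "'a::order set \<Rightarrow> 'a set" where
  "max_elts I = {p \<in> I. \<forall>q\<in>I. \<not> p < q}"

text \<open>For an ideal these index its upper covers: exactly these points can be added.\<close>

definition min_elts_outside :: "'a::order set \<Rightarrow> 'a set \<Rightarrow> 'a set" where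
  "min_elts_outside P I = {q \<in> P - I. \<forall>p\<in>P. p < q \<longrightarrow> p \<in> I}"

text \<open>The hypotheses carried from the lattice to its points. An ideal stands for a lattice
  element, \<open>differential\<close> is the equation at that element,
  \<open>finite_min_elts\<close> is finiteness of upper covers, and \<open>connected\<close> is what
  indecomposability becomes.\<close>

locale differential_poset =
  fixes P :: "'a::order set" and w :: "'a \<Rightarrow> int" and r :: int
  assumes finite_below: "p \<in> P \<Longrightarrow> finite {q \<in> P. q \<le> p}"
    and finite_min_elts: "fin_ideal P I \<Longrightarrow> finite (min_elts_outside P I)"
    and differential: "fin_ideal P I \<Longrightarrow> sum w (max_elts I) + r = sum w (min_elts_outside P I)"
    and ucm: "unique_cover_modular P"
    and w_pos: "p \<in> P \<Longrightarrow> w p > 0"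
    and r_pos: "r > 0"
    and connected: "\<lbrakk>A \<subseteq> P; A \<noteq> {}; \<And>p q. p \<in> A \<Longrightarrow> q \<in> P \<Longrightarrow> p \<le> q \<or> q \<le> p \<Longrightarrow> q \<in> A\<rbrakk> \<Longrightarrow> A = P"
begin

definition lo :: "'a \<Rightarrow> 'a set" where "lo p = {c. covers_in P c p}"
definition up :: "'a \<Rightarrow> 'a set" where "up p = {q. covers_in P p q}"

lemma lo_up: "c \<in> lo p \<longleftrightarrow> p \<in> up c"
  by (simp add: lo_def up_def)

lemma loD: "c \<in> lo p \<Longrightarrow> c \<in> P \<and> p \<in> P \<and> c < p"
  by (simp add: lo_def covers_in_def)

lemma upD: "q \<in> up p \<Longrightarrow> p \<in> P \<and> q \<in> P \<and> p < q"
  by (simp add: up_def covers_in_def)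

lemma below_card_less:
  assumes "p \<in> P" "q \<in> P" "q < p"
  shows "card {z \<in> P. z \<le> q} < card {z \<in> P. z \<le> p}"
proof (rule psubset_card_mono[OF finite_below[OF assms(1)]])
  have "p \<notin> {z \<in> P. z \<le> q}" using assms by auto
  moreover have "{z \<in> P. z \<le> q} \<subseteq> {z \<in> P. z \<le> p}" "p \<in> {z \<in> P. z \<le> p}"
    using assms by (auto intro: order.trans less_imp_le)
  ultimately show "{z \<in> P. z \<le> q} \<subset> {z \<in> P. z \<le> p}" by blast
qed

text \<open>Principal ideals are finite, so the number of points below \<open>p\<close> is a
  strictly increasing measure.\<close>

lemma below_induct [consumes 1, case_names less]:
  assumes "p \<in> P" and step: "\<And>p. p \<in> P \<Longrightarrow> (\<And>q. q \<in> P \<Longrightarrow> q < p \<Longrightarrow> R q) \<Longrightarrow> R p"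
  shows "R p"
  using assms(1)
proof (induction "card {q \<in> P. q \<le> p}" arbitrary: p rule: less_induct)
  case less
  show ?case
    by (rule step[OF less.prems less.hyps]) (use below_card_less less.prems in blast)+
qed

lemma ex_lo_between:
  assumes "x \<in> P" "p \<in> P" "x < p"
  shows "\<exists>c\<in>lo p. x \<le> c"
proof -
  let ?S = "{c \<in> P. x \<le> c \<and> c < p}"
  have "finite ?S"
    by (rule finite_subset[OF _ finite_below[OF assms(2)]]) auto
  moreover have "?S \<noteq> {}" using assms by auto
  ultimately obtain c where c: "c \<in> ?S" "\<forall>z\<in>?S. c \<le> z \<longrightarrow> c = z"
    using finite_has_maximal[of ?S] by blast
  have "\<not> (c < z \<and> z < p)" if "z \<in> P" for z
  proof
    assume z: "c < z \<and> z < p"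
    then have "z \<in> ?S" using that c(1) by auto
    then show False using c(2) z by auto
  qed
  with c(1) assms(2) have "c \<in> lo p" by (simp add: lo_def covers_in_def)
  with c show ?thesis by auto
qed

lemma finite_lo: "finite (lo p)"
proof (cases "p \<in> P")
  case True
  show ?thesis
    by (rule finite_subset[OF _ finite_below[OF True]]) (auto dest: loD)
next
  case False
  then have "lo p = {}" using loD by blast
  then show ?thesis by simp
qed

section \<open>Unique covers, the rank function and the minimum\<close>

lemma common_cover:
  assumes "x \<noteq> y" and "(\<exists>z. z \<in> lo x \<and> z \<in> lo y) \<or> (\<exists>z. z \<in> up x \<and> z \<in> up y)"
  shows "\<exists>!z. z \<in> lo x \<and> z \<in> lo y" and "\<exists>!z. z \<in> up x \<and> z \<in> up y"
proof -
  have "x \<in> P" "y \<in> P" using assms(2) loD upD by blast+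
  then have "(\<exists>!z. z \<in> lo x \<and> z \<in> lo y) \<and> (\<exists>!z. z \<in> up x \<and> z \<in> up y)"
    using ucm[unfolded unique_cover_modular_def, rule_format, of x y] assms
    unfolding lo_def up_def mem_Collect_eq by blast
  then show "\<exists>!z. z \<in> lo x \<and> z \<in> lo y" "\<exists>!z. z \<in> up x \<and> z \<in> up y" by blast+
qed

lemma lo_unique: "\<lbrakk>x \<noteq> y; c \<in> lo x; c \<in> lo y; d \<in> lo x; d \<in> lo y\<rbrakk> \<Longrightarrow> c = d"
  using common_cover(1)[of x y] by blast

lemma up_unique: "\<lbrakk>x \<noteq> y; c \<in> up x; c \<in> up y; d \<in> up x; d \<in> up y\<rbrakk> \<Longrightarrow> c = d"
  using common_cover(2)[of x y] by blast

text \<open>Follows one chosen lower cover at a time down to a minimal point; \<open>rk_lo\<close>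
  shows that the choice does not matter.\<close>

function rk :: "'a \<Rightarrow> nat" where
  "rk p = (if lo p = {} then 0 else Suc (rk (SOME c. c \<in> lo p)))"
  by auto
termination
proof (relation "measure (\<lambda>p. card {q \<in> P. q \<le> p})")
  fix p assume "lo p \<noteq> {}"
  then have "(SOME c. c \<in> lo p) \<in> lo p" by (rule some_in_eq[THEN iffD2])
  then show "((SOME c. c \<in> lo p), p) \<in> measure (\<lambda>p. card {q \<in> P. q \<le> p})"
    using below_card_less loD by simp
qed simp

declare rk.simps [simp del]

text \<open>Two lower covers of \<open>p\<close> are both covered by \<open>p\<close>, so they cover
  a common point \<open>d\<close>, and by induction both have rank
  \<open>Suc (rk d)\<close>.\<close>

lemma rk_lo: "c \<in> lo p \<Longrightarrow> rk p = Suc (rk c)"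
proof -
  assume c: "c \<in> lo p"
  then have "p \<in> P" using loD by blast
  then show ?thesis using c
  proof (induction p arbitrary: c rule: below_induct)
    case (less p)
    let ?s = "SOME c. c \<in> lo p"
    have s: "?s \<in> lo p" using less.prems by (rule someI)
    have eq: "rk p = Suc (rk ?s)" using less.prems by (subst rk.simps) auto
    show ?case
    proof (cases "c = ?s")
      case False
      then obtain d where "d \<in> lo c" "d \<in> lo ?s"
        using common_cover(1)[of c ?s] less.prems s lo_up by metis
      then have "rk c = rk ?s"
        using less.IH loD less.prems s by metis
      then show ?thesis using eq by simp
    qed (use eq in simp)
  qed
qed

lemma rk_less:
  assumes "x \<in> P" "p \<in> P" "x < p"
  shows "rk x < rk p"
  using assms(2,3)
proof (induction p rule: below_induct)
  case (less p)
  then obtain c where c: "c \<in> lo p" "x \<le> c" using ex_lo_between assms(1) by blast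
  then have "rk x \<le> rk c" using less.IH[of c] loD by (cases "x = c") (auto intro: less_imp_le)
  then show ?case using rk_lo[OF c(1)] by simp
qed

text \<open>A lower cover of \<open>p\<close> above \<open>c\<close> has the rank of
  \<open>c\<close>, hence equals \<open>c\<close> because rank is strictly monotone.\<close>

lemma lo_iff_rk:
  assumes "c \<in> P" "p \<in> P" "c < p" "rk p = Suc (rk c)"
  shows "c \<in> lo p"
proof -
  obtain d where d: "d \<in> lo p" "c \<le> d" using ex_lo_between assms by blast
  then have "rk d = rk c" using rk_lo assms by fastforce
  then have "c = d" using rk_less[of c d] d loD assms by (metis less_irrefl order_le_less)
  then show ?thesis using d by simp
qed

text \<open>The points above a minimal point \<open>m\<close> are closed under comparability, so by
  connectedness they are all of \<open>P\<close>, and a second minimal point lies above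
  \<open>m\<close>.\<close>

lemma bottom_unique:
  assumes "m \<in> P" "lo m = {}" "m' \<in> P" "lo m' = {}"
  shows "m = m'"
proof -
  define A where "A = {p \<in> P. m \<le> p}"
  \<comment> \<open>Descent to an arbitrary lower cover \<open>c\<close>: some lower cover
    \<open>d\<close> of \<open>p\<close> lies above \<open>m\<close>, and the point covered by both
    \<open>c\<close> and \<open>d\<close> lies above \<open>m\<close> by induction.\<close>
  have down: "p \<in> P \<Longrightarrow> m \<le> p \<Longrightarrow> c \<in> lo p \<Longrightarrow> m \<le> c" for p c
  proof (induction p arbitrary: c rule: below_induct)
    case (less p)
    show ?case
    proof (rule ccontr)
      assume nc: "\<not> m \<le> c"
      have "m \<noteq> p" using less.prems assms(2) by auto
      then obtain d where d: "d \<in> lo p" "m \<le> d"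
        using ex_lo_between[of m p] less assms(1) by (metis order_le_less)
      with nc have "c \<noteq> d" by auto
      then obtain e where e: "e \<in> lo c" "e \<in> lo d"
        using common_cover(1)[of c d] less.prems d lo_up by metis
      have "m \<le> e" using less.IH[of d e] d e loD by blast
      then show False using nc e loD by (metis order.trans less_imp_le)
    qed
  qed
  have down': "p \<in> P \<Longrightarrow> m \<le> p \<Longrightarrow> q \<in> P \<Longrightarrow> q \<le> p \<Longrightarrow> m \<le> q" for p q
  proof (induction p rule: below_induct)
    case (less p)
    show ?case
    proof (cases "q = p")
      case False
      then obtain c where c: "c \<in> lo p" "q \<le> c" using ex_lo_between[of q p] less.prems less.hyps by (metis order_le_less)
      have "c \<in> P" "c < p" using loD c by auto
      moreover have "m \<le> c" using down[OF less.hyps less.prems(1) c(1)] .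
      ultimately show ?thesis using less.IH[of c] less.prems c(2) by simp
    qed (use less.prems in simp)
  qed
  have "A = P"
  proof (rule connected)
    show "A \<noteq> {}" using assms A_def by auto
    show "q \<in> A" if "p \<in> A" "q \<in> P" "p \<le> q \<or> q \<le> p" for p q
    proof -
      have "m \<le> q" using that down'[of p q] order.trans[of m p q] by (auto simp: A_def)
      then show ?thesis using that by (simp add: A_def)
    qed
  qed (auto simp: A_def)
  then have "m \<le> m'" using assms A_def by auto
  then show ?thesis using assms ex_lo_between[of m m'] by (metis empty_iff order_le_less)
qed

text \<open>The equation at the empty ideal says that the minimal points weigh \<open>r\<close> in
  total, so positivity of \<open>r\<close> yields one.\<close>

lemma bottom:
  obtains z where "z \<in> P" "lo z = {}" "w z = r" "\<And>m. m \<in> P \<Longrightarrow> lo m = {} \<Longrightarrow> m = z"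
proof -
  have id: "fin_ideal P {}" by (simp add: fin_ideal_def)
  have min: "min_elts_outside P {} = {p \<in> P. lo p = {}}"
    using ex_lo_between loD by (fastforce simp: min_elts_outside_def)
  have sum: "sum w {p \<in> P. lo p = {}} = r"
    using differential[OF id] min by (simp add: max_elts_def)
  then have "{p \<in> P. lo p = {}} \<noteq> {}" using r_pos by force
  then obtain z where z: "z \<in> P" "lo z = {}" by auto
  then have "{p \<in> P. lo p = {}} = {z}" using bottom_unique by blast
  then have "w z = r" using sum by simp
  with z bottom_unique that show ?thesis by blast
qed

section \<open>The differential equation localised at one point\<close>

text \<open>The difference of the equations at \<open>I\<close> and at \<open>insert p I\<close>.
  Adding \<open>p\<close> removes from the maximal elements those below \<open>p\<close>, and
  replaces \<open>p\<close> among the minimal outside elements by those that become available above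
  it.\<close>

lemma add_point:
  assumes I: "fin_ideal P I" and p: "p \<in> min_elts_outside P I"
  shows "2 * w p = sum w {c \<in> max_elts I. c < p} + sum w {q \<in> min_elts_outside P (insert p I). p < q}"
proof -
  let ?I = "insert p I"
  have I': "fin_ideal P ?I"
    using I p by (auto simp: fin_ideal_def min_elts_outside_def order_le_less)
  have pI: "p \<notin> I" "p \<in> P" using p by (auto simp: min_elts_outside_def)
  have nb: "\<not> p < q" if "q \<in> I" for q
    using that pI I by (auto simp: fin_ideal_def dest: less_imp_le)
  have fI: "finite (max_elts I)" using I by (simp add: fin_ideal_def max_elts_def)
  have mx: "max_elts ?I = insert p (max_elts I - {c \<in> max_elts I. c < p})"
    using nb pI by (auto simp: max_elts_def)
  have mx_sum: "sum w (max_elts ?I) = w p + sum w (max_elts I) - sum w {c \<in> max_elts I. c < p}"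
  proof -
    have "p \<notin> max_elts I - {c \<in> max_elts I. c < p}" using pI by (auto simp: max_elts_def)
    moreover have "sum w (max_elts I - {c \<in> max_elts I. c < p})
        = sum w (max_elts I) - sum w {c \<in> max_elts I. c < p}"
      by (rule sum_diff[OF fI]) auto
    ultimately show ?thesis unfolding mx using fI by simp
  qed
  have mn: "min_elts_outside P ?I
      = (min_elts_outside P I - {p}) \<union> {q \<in> min_elts_outside P ?I. p < q}"
    by (auto simp: min_elts_outside_def)
  have "sum w (min_elts_outside P ?I)
      = sum w (min_elts_outside P I - {p}) + sum w {q \<in> min_elts_outside P ?I. p < q}"
  proof (subst mn, rule sum.union_disjoint)
    show "finite {q \<in> min_elts_outside P ?I. p < q}"
      using finite_min_elts[OF I'] by simp
  qed (use finite_min_elts[OF I] pI in \<open>auto simp: min_elts_outside_def\<close>)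
  also have "sum w (min_elts_outside P I - {p}) = sum w (min_elts_outside P I) - w p"
    using p finite_min_elts[OF I] by (simp add: sum_diff1)
  finally show ?thesis
    using mx_sum differential[OF I] differential[OF I'] by linarith
qed

text \<open>Applies \<open>add_point\<close> to the ideal generated by \<open>A\<close> and the
  points strictly below \<open>p\<close>. Elements of \<open>A\<close> have the rank of
  \<open>p\<close>, so \<open>p\<close> can be added. A lower cover of \<open>p\<close> is maximal
  in the ideal unless an element of \<open>A\<close> covers it, and an upper cover becomes available
  when all its lower covers lie in \<open>insert p A\<close>.\<close>

lemma local_equation:
  assumes p: "p \<in> P" and A: "finite A" "A \<subseteq> P" "p \<notin> A" "\<And>a. a \<in> A \<Longrightarrow> rk a = rk p"
  shows "2 * w p = sum w {c \<in> lo p. \<forall>a\<in>A. c \<notin> lo a} + sum w {q \<in> up p. lo q \<subseteq> insert p A}"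
    and "finite {q \<in> up p. lo q \<subseteq> insert p A}"
proof -
  define I where "I = {x \<in> P. x < p \<or> (\<exists>a\<in>A. x \<le> a)}"
  have fin: "finite I"
    by (rule finite_subset[of _ "{x \<in> P. x \<le> p} \<union> (\<Union>a\<in>A. {x \<in> P. x \<le> a})"])
      (use A p finite_below in \<open>auto simp: I_def\<close>)
  have I: "fin_ideal P I"
    using fin unfolding fin_ideal_def I_def by (auto intro: order.trans order.strict_trans1)
  have rkI: "rk x < rk p \<or> x \<in> A" if "x \<in> I" for x
  proof -
    have "x \<in> P" "x < p \<or> (\<exists>a\<in>A. x = a \<or> x < a)"
      using that by (auto simp: I_def order_le_less)
    then show ?thesis using rk_less[of x] A p by (metis subsetD)
  qed
  have pI: "p \<notin> I" using rkI A by blast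
  then have pm: "p \<in> min_elts_outside P I" using p by (auto simp: min_elts_outside_def I_def)
  have 1: "{c \<in> max_elts I. c < p} = {c \<in> lo p. \<forall>a\<in>A. c \<notin> lo a}"
  proof (intro equalityI subsetI)
    fix c assume "c \<in> {c \<in> max_elts I. c < p}"
    then have c: "c \<in> I" "\<And>q. q \<in> I \<Longrightarrow> \<not> c < q" "c < p" "c \<in> P"
      by (auto simp: max_elts_def I_def)
    have "c \<in> lo p" using c p unfolding lo_def covers_in_def I_def by auto
    moreover have "c \<notin> lo a" if "a \<in> A" for a
      using c(2)[of a] that A(2) loD unfolding I_def by auto
    ultimately show "c \<in> {c \<in> lo p. \<forall>a\<in>A. c \<notin> lo a}" by blast
  next
    fix c assume "c \<in> {c \<in> lo p. \<forall>a\<in>A. c \<notin> lo a}"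
    then have c: "c \<in> lo p" "\<And>a. a \<in> A \<Longrightarrow> c \<notin> lo a" "c \<in> P" "c < p" by (auto dest: loD)
    have "\<not> c < q" if q: "q \<in> I" for q
    proof
      assume cq: "c < q"
      have "q \<in> P" using q I_def by auto
      then have "rk c < rk q" using cq rk_less c by blast
      then have "q \<in> A" using rkI[OF q] rk_lo[OF c(1)] by auto
      then show False using c(2)[of q] lo_iff_rk[of c q] c \<open>q \<in> P\<close> cq rk_lo[OF c(1)] A(4)[of q] by simp
    qed
    then show "c \<in> {c \<in> max_elts I. c < p}"
      using c by (auto simp: max_elts_def I_def)
  qed
  have 2: "{q \<in> min_elts_outside P (insert p I). p < q} = {q \<in> up p. lo q \<subseteq> insert p A}"
  proof (intro equalityI subsetI)
    fix q assume "q \<in> {q \<in> min_elts_outside P (insert p I). p < q}"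
    then have q: "q \<in> P" "q \<notin> I" "q \<noteq> p" "\<And>x. x \<in> P \<Longrightarrow> x < q \<Longrightarrow> x \<in> insert p I" "p < q"
      by (auto simp: min_elts_outside_def)
    \<comment> \<open>Points above \<open>p\<close> are outside \<open>I\<close>, so nothing lies
      strictly between \<open>p\<close> and the new minimal point \<open>q\<close>.\<close>
    have "z \<notin> I" if "z \<in> P" "p < z" for z
      using that I pI p unfolding fin_ideal_def by (meson less_imp_le)
    then have pq: "p \<in> lo q" using q p unfolding lo_def covers_in_def by blast
    have "x \<in> insert p A" if "x \<in> lo q" for x
    proof -
      have "rk x = rk p" using rk_lo[OF that] rk_lo[OF pq] by simp
      then show ?thesis using q(4)[of x] that loD rkI[of x] by auto
    qed
    then show "q \<in> {q \<in> up p. lo q \<subseteq> insert p A}" using pq lo_up by blast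
  next
    fix q assume "q \<in> {q \<in> up p. lo q \<subseteq> insert p A}"
    then have q: "p \<in> lo q" "lo q \<subseteq> insert p A" using lo_up by auto
    have qP: "q \<in> P" "p < q" using q loD by auto
    have "rk q = Suc (rk p)" using rk_lo q by blast
    then have "q \<notin> insert p I" using rkI[of q] A(4)[of q] by auto
    moreover have "x \<in> insert p I" if x: "x \<in> P" "x < q" for x
    proof -
      obtain c where c: "c \<in> lo q" "x \<le> c" using ex_lo_between x qP by blast
      then have "c = p \<or> c \<in> A" using q by auto
      then show ?thesis using c x unfolding I_def by (auto simp: order_le_less)
    qed
    ultimately show "q \<in> {q \<in> min_elts_outside P (insert p I). p < q}"
      using qP by (auto simp: min_elts_outside_def)
  qed
  show "2 * w p = sum w {c \<in> lo p. \<forall>a\<in>A. c \<notin> lo a} + sum w {q \<in> up p. lo q \<subseteq> insert p A}"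
    using add_point[OF I pm] 1 2 by simp
  have "fin_ideal P (insert p I)"
    using I pm by (auto simp: fin_ideal_def min_elts_outside_def order_le_less)
  from finite_min_elts[OF this] show "finite {q \<in> up p. lo q \<subseteq> insert p A}"
    unfolding 2[symmetric] by simp
qed

text \<open>The upper covers of \<open>p\<close> that are not the top of a square containing
  \<open>p\<close>, called single covers below.\<close>

definition sg :: "'a \<Rightarrow> 'a set" where "sg p = {q. lo q = {p}}"

lemma sg_up: "sg p \<subseteq> up p"
  by (auto simp: sg_def lo_up[symmetric])

lemma sg_eq: "{q \<in> up p. lo q \<subseteq> {p}} = sg p"
  by (auto simp: sg_def lo_up[symmetric])

text \<open>The local equation with \<open>A = {}\<close>, where the ideal is everything strictly
  below \<open>p\<close>.\<close>

lemma balance: "2 * w p = sum w (lo p) + sum w (sg p)" (is ?A)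
  and finite_sg: "finite (sg p)" (is ?B)
  if "p \<in> P"
proof -
  have lo: "{c \<in> lo p. \<forall>a\<in>{}. c \<notin> lo a} = lo p" by simp
  show ?A ?B
    using local_equation[OF that, of "{}", unfolded lo sg_eq] by blast+
qed

text \<open>Passing from \<open>A = {}\<close> to \<open>A = {a}\<close> in the local equation loses
  exactly the common lower cover \<open>c\<close> and gains the points with lower covers
  \<open>{p, a}\<close>. Their total weight is \<open>w c > 0\<close>, so one exists, and unique
  covers make it the only one.\<close>

lemma square:
  assumes "p \<noteq> a" "c \<in> lo p" "c \<in> lo a"
  shows "\<exists>q. lo q = {p, a} \<and> w q = w c"
proof -
  have P: "p \<in> P" "a \<in> P" using assms loD by auto
  have rk: "rk a = rk p" using rk_lo assms by metis
  have lo: "{x \<in> lo p. \<forall>a\<in>{a}. x \<notin> lo a} = lo p - {c}"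
    using assms lo_unique[of p a] by auto
  let ?J = "{q \<in> up p. lo q \<subseteq> insert p {a}}"
  have fJ: "finite ?J" and eq: "2 * w p = sum w (lo p - {c}) + sum w ?J"
    using local_equation[of p "{a}"] P assms(1) rk unfolding lo by auto
  have J: "?J = sg p \<union> {q. lo q = {p, a}}"
    by (auto simp: sg_def lo_up[symmetric])
  have "sum w ?J = sum w (sg p) + sum w {q. lo q = {p, a}}"
    unfolding J by (rule sum.union_disjoint) (use fJ J assms(1) in \<open>auto simp: sg_def\<close>)
  then have s: "w c = sum w {q. lo q = {p, a}}"
    using eq balance[OF P(1)] assms(2) finite_lo by (simp add: sum_diff1)
  then have "{q. lo q = {p, a}} \<noteq> {}" using w_pos loD assms by (metis less_irrefl sum.empty)
  then obtain q where q: "lo q = {p, a}" by auto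
  have u: "q' = q" if "lo q' = {p, a}" for q'
    by (rule up_unique[OF assms(1)]) (use that q in \<open>simp_all add: lo_up[symmetric]\<close>)
  have "{q. lo q = {p, a}} = {q}" using q u by blast
  with q s show ?thesis by auto
qed

text \<open>\<open>p\<close> and \<open>a\<close> cover a common point, so \<open>square\<close>
  supplies a point with exactly these lower covers; it is \<open>q\<close> because the upper cover
  of a pair is unique.\<close>

lemma lo_pair:
  assumes "p \<in> lo q" "a \<in> lo q" "p \<noteq> a"
  shows "lo q = {p, a}"
proof -
  obtain c where c: "c \<in> lo p" "c \<in> lo a" using common_cover(1)[of p a] assms lo_up by metis
  then obtain q' where "lo q' = {p, a}" using square assms by blast
  moreover have "q' = q" using up_unique[OF assms(3), of q' q] assms calculation lo_up by blast
  ultimately show ?thesis by simp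
qed

text \<open>With a third upper cover \<open>b\<close>, the local equation for \<open>p\<close> and
  \<open>A = {a, b}\<close> still loses only \<open>c\<close> but gains the tops of two squares,
  each of weight \<open>w c\<close>.\<close>

lemma up_pair:
  assumes "p \<in> up c" "a \<in> up c" "p \<noteq> a"
  shows "up c = {p, a}"
proof (rule ccontr)
  assume "up c \<noteq> {p, a}"
  then obtain b where b: "b \<in> up c" "b \<noteq> p" "b \<noteq> a" using assms by auto
  have c: "c \<in> lo p" "c \<in> lo a" "c \<in> lo b" using assms b lo_up by auto
  have P: "p \<in> P" "a \<in> P" "b \<in> P" "c \<in> P" using c loD by auto
  have rk: "rk a = rk p" "rk b = rk p" using rk_lo c by metis+
  have lo: "{x \<in> lo p. \<forall>a\<in>{a, b}. x \<notin> lo a} = lo p - {c}"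
    using c lo_unique[of p a] lo_unique[of p b] assms b by auto
  let ?J = "{q \<in> up p. lo q \<subseteq> insert p {a, b}}"
  have fJ: "finite ?J" and eq: "2 * w p = sum w (lo p - {c}) + sum w ?J"
    using local_equation[of p "{a, b}"] P assms(3) b rk unfolding lo by auto
  obtain x where x: "lo x = {p, a}" "w x = w c" using square assms c by blast
  obtain y where y: "lo y = {p, b}" "w y = w c" using square b c by metis
  have xy: "x \<noteq> y" "x \<notin> sg p" "y \<notin> sg p" using x y b assms(3) by (auto simp: sg_def doubleton_eq_iff)
  have sub: "insert x (insert y (sg p)) \<subseteq> ?J" using x y by (auto simp: sg_def lo_up[symmetric])
  have "sum w (insert x (insert y (sg p))) \<le> sum w ?J"
    by (rule sum_mono2[OF fJ sub]) (use upD w_pos in \<open>auto intro: less_imp_le\<close>)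
  then have "w c + w c + sum w (sg p) \<le> sum w ?J"
    using xy x y finite_sg[OF P(1)] by simp
  then show False
    using eq balance[OF P(1)] c(1) finite_lo w_pos[OF P(4)] by (simp add: sum_diff1)
qed

text \<open>The top of the square on \<open>p\<close> and \<open>a\<close>; meaningful when they are
  distinct and cover a common point.\<close>

definition jn :: "'a \<Rightarrow> 'a \<Rightarrow> 'a" where "jn p a = (THE q. lo q = {p, a})"

lemma jn_commute: "jn p a = jn a p"
  by (simp add: jn_def insert_commute)

lemma jn:
  assumes "p \<noteq> a" "c \<in> lo p" "c \<in> lo a"
  shows "lo (jn p a) = {p, a}" and "w (jn p a) = w c" and "\<And>q. lo q = {p, a} \<Longrightarrow> q = jn p a"
    and "jn p a \<in> up p" and "jn p a \<in> up a"
proof -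
  obtain q where q: "lo q = {p, a}" "w q = w c" using square assms by blast
  have u: "q' = q" if "lo q' = {p, a}" for q'
    by (rule up_unique[OF assms(1)]) (use that q in \<open>simp_all add: lo_up[symmetric]\<close>)
  have jq: "jn p a = q" unfolding jn_def by (rule the_equality) (use q u in blast)+
  show j: "lo (jn p a) = {p, a}" "w (jn p a) = w c" using q jq by simp_all
  show "\<And>q. lo q = {p, a} \<Longrightarrow> q = jn p a" unfolding jq by (rule u)
  show "jn p a \<in> up p" and "jn p a \<in> up a" unfolding lo_up[symmetric] j(1) by auto
qed

section \<open>Siblings and the upper covers of a point\<close>

lemma up_cases:
  assumes "q \<in> up p"
  shows "q \<in> sg p \<or> (\<exists>a c. a \<noteq> p \<and> c \<in> lo p \<and> up c = {p, a} \<and> lo q = {p, a} \<and> q = jn p a)"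
proof (cases "lo q = {p}")
  case False
  then obtain a where a: "a \<in> lo q" "a \<noteq> p" using assms lo_up by blast
  then have q: "lo q = {p, a}" using lo_pair assms lo_up by metis
  obtain c where c: "c \<in> lo p" "c \<in> lo a" using common_cover(1)[of p a] a assms lo_up by metis
  moreover have "up c = {p, a}" using up_pair lo_up c a by metis
  moreover have "q = jn p a" using jn(3)[of p a c q] a c q by metis
  ultimately show ?thesis using a q by blast
qed (simp add: sg_def)

text \<open>The neighbours of \<open>p\<close> in the path formed by its rank. By unique covers,
  sharing a lower cover and sharing an upper cover are the same.\<close>

definition sib :: "'a \<Rightarrow> 'a set" where "sib p = (\<Union>c\<in>lo p. up c) - {p}"

lemma sibD: "a \<in> sib p \<Longrightarrow> lo (jn p a) = {p, a} \<and> jn p a \<in> up p \<and> p \<noteq> a \<and> (\<exists>c\<in>lo p. c \<in> lo a)"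
  using jn[of p a] lo_up by (auto simp: sib_def)

lemma up_eq: "up p = sg p \<union> jn p ` sib p"
proof (intro equalityI subsetI)
  fix q assume "q \<in> up p"
  then show "q \<in> sg p \<union> jn p ` sib p" using up_cases[of q p] by (auto simp: sib_def)
next
  fix q assume "q \<in> sg p \<union> jn p ` sib p"
  then show "q \<in> up p"
    using sg_up sibD by blast
qed

text \<open>Of at most two upper covers one is the join with the sibling; the balance equation
  decides whether there is a single cover besides it, and fixes its weight.\<close>

lemma one_sibling:
  assumes "p \<in> P" "sib p = {a}"
  shows "(2 * w p = sum w (lo p) \<and> up p = {jn p a} \<and> sg p = {}) \<or>
    (\<exists>q. q \<noteq> jn p a \<and> up p = {jn p a, q} \<and> lo q = {p} \<and> w q = 2 * w p - sum w (lo p) \<and> w q > 0 \<and> sg p = {q})"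
proof (cases "sg p = {}")
  case True
  then show ?thesis using balance[OF assms(1)] up_eq[of p] assms(2) by simp
next
  case False
  then obtain q where q: "q \<in> sg p" by auto
  have a: "lo (jn p a) = {p, a}" "jn p a \<in> up p" "p \<noteq> a" using sibD[of a p] assms by auto
  have qp: "lo q = {p}" "q \<in> up p" using q sg_up by (auto simp: sg_def)
  have ne: "q \<noteq> jn p a" using a qp by auto
  then have up: "up p = {jn p a, q}" using up_pair a qp by metis
  have "jn p a \<notin> sg p" using a by (auto simp: sg_def)
  then have sgq: "sg p = {q}" using up q sg_up[of p] by auto
  then have "w q = 2 * w p - sum w (lo p)" using balance[OF assms(1)] by simp
  moreover have "w q > 0" using w_pos qp upD by blast
  ultimately show ?thesis using ne up qp sgq by blast
qed

text \<open>The two joins exhaust the upper covers, so no single cover enters the balance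
  equation.\<close>

lemma two_siblings:
  assumes "p \<in> P" "a \<in> sib p" "b \<in> sib p" "a \<noteq> b"
  shows "up p = {jn p a, jn p b}" "2 * w p = sum w (lo p)" "jn p a \<noteq> jn p b" "sg p = {}"
proof -
  have a: "lo (jn p a) = {p, a}" "jn p a \<in> up p" "p \<noteq> a"
    and b: "lo (jn p b) = {p, b}" "jn p b \<in> up p" "p \<noteq> b"
    using sibD assms by auto
  show ne: "jn p a \<noteq> jn p b" using a b assms(4) by (auto simp: doubleton_eq_iff)
  then show up: "up p = {jn p a, jn p b}" using up_pair a b by metis
  have "jn p a \<notin> sg p" "jn p b \<notin> sg p" using a b by (auto simp: sg_def)
  then show "sg p = {}" using sg_up[of p] up by auto
  then show "2 * w p = sum w (lo p)" using balance[OF assms(1)] by simp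
qed

lemma sib_lo1: "\<lbrakk>lo p = {c}; up c = {p, a}; p \<noteq> a\<rbrakk> \<Longrightarrow> sib p = {a}"
  by (auto simp: sib_def)

lemma sib_lo2: "\<lbrakk>lo p = {u, v}; up u = {p}; up v = {p, a}; p \<noteq> a\<rbrakk> \<Longrightarrow> sib p = {a}"
  by (auto simp: sib_def)

lemma sib_lo22: "\<lbrakk>lo p = {u, v}; up u = {p, a}; up v = {p, b}; p \<noteq> a; p \<noteq> b\<rbrakk> \<Longrightarrow> sib p = {a, b}"
  by (auto simp: sib_def)

end

section \<open>Branching of the initial chain\<close>

context differential_poset
begin

lemma sibling_join:
  assumes "up c = {p, a}" "p \<noteq> a"
  shows "lo (jn p a) = {p, a}" "w (jn p a) = w c" "c \<in> P" "p \<in> P" "a \<in> P"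
proof -
  have "c \<in> lo p" "c \<in> lo a" using assms by (auto simp: lo_up)
  then show "lo (jn p a) = {p, a}" "w (jn p a) = w c" "c \<in> P" "p \<in> P" "a \<in> P"
    using jn[OF assms(2)] loD by blast+
qed

text \<open>\<open>p\<close> ends the path of its rank. Whether \<open>2 * w p - w c\<close> is zero
  or positive decides whether the path of the next rank stops at \<open>jn p a\<close> or extends by
  one point.\<close>

lemma up_end1:
  assumes "lo p = {c}" "up c = {p, a}" "p \<noteq> a"
  shows "(2 * w p = w c \<and> up p = {jn p a}) \<or>
    (\<exists>q. q \<noteq> jn p a \<and> up p = {jn p a, q} \<and> lo q = {p} \<and> w q = 2 * w p - w c \<and> w q > 0)"
  using one_sibling[OF _ sib_lo1[OF assms]] assms(1) sibling_join(4)[OF assms(2,3)] by auto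

text \<open>The other kind of end, where \<open>p\<close> is alone above one of its two lower
  covers.\<close>

lemma up_end2:
  assumes "lo p = {u, v}" "u \<noteq> v" "up u = {p}" "up v = {p, a}" "p \<noteq> a"
  shows "(2 * w p = w u + w v \<and> up p = {jn p a}) \<or>
    (\<exists>q. q \<noteq> jn p a \<and> up p = {jn p a, q} \<and> lo q = {p} \<and> w q = 2 * w p - (w u + w v) \<and> w q > 0)"
  using one_sibling[OF _ sib_lo2[OF assms(1,3-5)]] assms(1,2) sibling_join(4)[OF assms(4,5)] by auto

text \<open>With siblings on both sides, the weight of \<open>p\<close> is the mean of its lower
  covers. This equation produces the contradictions in this section.\<close>

lemma up_inner:
  assumes "lo p = {u, v}" "u \<noteq> v" "up u = {p, a}" "up v = {p, b}" "p \<noteq> a" "p \<noteq> b"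
  shows "2 * w p = w u + w v" "up p = {jn p a, jn p b}" "jn p a \<noteq> jn p b"
proof -
  have "a \<noteq> b" using lo_unique[of p a u v] assms by (auto simp: lo_up)
  then show "2 * w p = w u + w v" "up p = {jn p a, jn p b}" "jn p a \<noteq> jn p b"
    using two_siblings[of p a b] sib_lo22[OF assms(1,3-6)] sibling_join(4)[OF assms(3,5)] assms(1,2)
    by simp_all
qed

text \<open>The weights above the branch point \<open>s\<close> are forced rank by rank, in units of
  \<open>u\<close>: each \<open>jn\<close> inherits the weight of the bottom of its square and ends
  are extended by \<open>up_end1\<close> and \<open>up_end2\<close>, until an inner point violates
  \<open>up_inner\<close>.\<close>

lemma branch_E8:
  fixes m :: int
  assumes up_s: "up s = {b, b'}" and ne: "b \<noteq> b'" and lo_b: "lo b = {s}" "lo b' = {s}"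
    and w: "w s = (m + 1) * u" "2 * w b = (m + 3) * u" "2 * w b' = (m + 1) * u" and "u > 0"
    and stop: "up b' = {jn b b'}" and m: "m \<ge> 2"
  shows False
proof -
  define d where "d = jn b b'"
  have d: "lo d = {b, b'}" "w d = (m + 1) * u"
    using sibling_join[OF up_s ne] w d_def by simp_all
  have pos: "m * u > 0" "(m - 1) * u > 0" using m \<open>u > 0\<close> by simp_all
  obtain e where e: "e \<noteq> d" "up b = {d, e}" "lo e = {b}" "w e = 2 * u"
    using up_end1[OF lo_b(1) up_s ne] w pos d_def \<open>u > 0\<close> by (auto simp: algebra_simps)
  define g where "g = jn d e"
  have g: "lo g = {d, e}" "w g = w b" using sibling_join[OF e(2)] e(1) g_def by simp_all
  have up_d: "(2 * w d = w b' + w b \<and> up d = {g}) \<or>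
    (\<exists>q. q \<noteq> g \<and> up d = {g, q} \<and> lo q = {d} \<and> w q = 2 * w d - (w b' + w b) \<and> w q > 0)"
    using up_end2[of d b' b e] d(1) ne stop e g_def d_def by (simp add: insert_commute)
  have wbb: "w b' + w b = (m + 2) * u" using w by (simp add: algebra_simps)
  obtain f where f: "f \<noteq> g" "up d = {g, f}" "lo f = {d}" "w f = m * u"
    using up_d pos wbb d(2) by (auto simp: algebra_simps)
  define h where "h = jn f g"
  have h: "lo h = {f, g}" "w h = (m + 1) * u"
    using sibling_join[of d f g] f d h_def by (simp_all add: insert_commute)
  obtain f2 where f2: "f2 \<noteq> h" "up f = {h, f2}" "lo f2 = {f}" "w f2 = (m - 1) * u"
    using up_end1[of f d g] f d pos h_def by (auto simp: algebra_simps insert_commute)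
  have up_e: "(2 * w e = w b \<and> up e = {g}) \<or>
    (\<exists>q. q \<noteq> g \<and> up e = {g, q} \<and> lo q = {e} \<and> w q = 2 * w e - w b \<and> w q > 0)"
    using up_end1[of e b d] e g_def by (simp add: insert_commute jn_commute)
  have dg: "d \<noteq> e" using e by simp
  have lo_h: "f \<noteq> g" "lo h = {f, g}" using f h by auto
  \<comment> \<open>A second cover of \<open>e\<close> would make \<open>h\<close> an inner point
    with \<open>2 * w h = w f + w g\<close>, which no \<open>m \<ge> 2\<close> satisfies. So
    \<open>g\<close> is the only cover of \<open>e\<close>, and then \<open>2 * w e = w b\<close>
    gives \<open>m = 5\<close>.\<close>
  have m5: "m = 5 \<and> up e = {g}"
  proof (rule ccontr)
    assume "\<not> (m = 5 \<and> up e = {g})"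
    moreover have "m = 5" if "2 * w e = w b"
    proof -
      have "8 * u = (m + 3) * u" using that w e by linarith
      then show ?thesis using \<open>u > 0\<close> by simp
    qed
    ultimately obtain e2 where e2: "e2 \<noteq> g" "up e = {g, e2}" using up_e by blast
    have up_g: "up g = {jn g f, jn g e2}" "jn g f \<noteq> jn g e2"
      using up_inner[of g d e f e2] g f e2 dg by auto
    have "2 * w h = w f + w g"
      using up_inner(1)[of h f g f2 "jn g e2"] lo_h f2 up_g h_def by (simp add: jn_commute)
    then have "4 * (m + 1) * u = (2 * m + m + 3) * u"
      using h f g w by (simp add: algebra_simps)
    then have "4 * (m + 1) = 2 * m + m + 3" using \<open>u > 0\<close> by simp
    then show False using m by simp
  qed
  then have m: "m = 5" and up_e: "up e = {g}" by auto
  \<comment> \<open>These values decide every later choice between stopping and extending.\<close>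
  have W: "w b = 4 * u" "w d = 6 * u" "w e = 2 * u" "w f = 5 * u" "w g = 4 * u" "w h = 6 * u" "w f2 = 4 * u"
    using w d e f g h f2 m by simp_all
  have up_g: "up g = {h}"
    using up_end2[of g e d f] g up_e f dg W h_def by (auto simp: insert_commute jn_commute)
  define h2 where "h2 = jn h f2"
  have h2: "lo h2 = {h, f2}" "w h2 = 5 * u"
    using sibling_join[OF f2(2)] f2(1) W h2_def by simp_all
  obtain k1 where k1: "k1 \<noteq> h2" "up h = {h2, k1}" "lo k1 = {h}" "w k1 = 3 * u"
    using up_end2[of h g f f2] lo_h up_g f2 W h2_def \<open>u > 0\<close> by (auto simp: insert_commute)
  obtain f3 where f3: "f3 \<noteq> h2" "up f2 = {h2, f3}" "lo f3 = {f2}" "w f3 = 3 * u"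
    using up_end1[of f2 f h] f2 W h2_def \<open>u > 0\<close> by (auto simp: insert_commute jn_commute)
  define h3 where "h3 = jn h2 f3"
  have h3: "lo h3 = {h2, f3}" using sibling_join[OF f3(2)] f3(1) h3_def by simp
  obtain f4 where f4: "f4 \<noteq> h3" "up f3 = {h3, f4}"
    using up_end1[of f3 f2 h2] f3 W h3_def \<open>u > 0\<close> by (auto simp: insert_commute jn_commute)
  define k2 where "k2 = jn h2 k1"
  have k2: "lo k2 = {h2, k1}" "w k2 = 6 * u"
    using sibling_join[OF k1(2)] k1(1) W k2_def by simp_all
  have up_h2: "up h2 = {k2, h3}" "k2 \<noteq> h3"
    using up_inner[of h2 h f2 k1 f3] h2 f2 k1 f3 k2_def h3_def by auto
  have up_k1: "up k1 = {k2}"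
    using up_end1[of k1 h h2] k1 W k2_def by (auto simp: insert_commute jn_commute)
  define k3 where "k3 = jn k2 h3"
  have k3: "lo k3 = {k2, h3}" "w k3 = 5 * u"
    using sibling_join[OF up_h2] k3_def h2 by simp_all
  obtain l2 where l2: "l2 \<noteq> k3" "up k2 = {k3, l2}" "lo l2 = {k2}" "w l2 = 4 * u"
    using up_end2[of k2 k1 h2 h3] k2 k1 up_k1 up_h2 h2 k3_def \<open>u > 0\<close> by (auto simp: insert_commute)
  define l3 where "l3 = jn k3 l2"
  have l3: "lo l3 = {k3, l2}" "w l3 = 6 * u"
    using sibling_join[OF l2(2)] l2(1) l3_def k2 by simp_all
  obtain m2 where m2: "m2 \<noteq> l3" "up l2 = {l3, m2}"
    using up_end1[of l2 k2 k3] l2 k2 l3_def \<open>u > 0\<close> by (auto simp: insert_commute jn_commute)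
  have up_h3: "up h3 = {k3, jn h3 f4}" "k3 \<noteq> jn h3 f4"
    using up_inner[of h3 h2 f3 k2 f4] h3 f3 up_h2 f4 k3_def by (auto simp: insert_commute jn_commute)
  have up_k3: "up k3 = {l3, jn k3 (jn h3 f4)}" "l3 \<noteq> jn k3 (jn h3 f4)"
    using up_inner[of k3 k2 h3 l2 "jn h3 f4"] k3 up_h2(2) l2 up_h3 l3_def by auto
  \<comment> \<open>\<open>l3\<close> is an inner point, yet its weight \<open>6 * u\<close> is not
    the mean of \<open>5 * u\<close> and \<open>4 * u\<close>.\<close>
  have "2 * w l3 = w k3 + w l2"
    using up_inner(1)[of l3 k3 l2 "jn k3 (jn h3 f4)" m2] l3 l2 up_k3 m2 by auto
  then show False using l3 k3 l2 \<open>u > 0\<close> by simp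
qed

text \<open>\<open>s\<close> has no sibling, so no square produces a cover of it.\<close>

lemma chain_step:
  assumes "lo s = {t}" "up t = {s}" "q \<in> up s"
  shows "lo q = {s}"
proof -
  have "sib s = {}" using assms by (auto simp: sib_def)
  then show ?thesis using assms up_eq[of s] by (simp add: sg_def)
qed

text \<open>Balance at \<open>s\<close> gives \<open>w b + w b' = (m + 2) * u\<close>. If both
  \<open>b\<close> and \<open>b'\<close> had a cover besides their join \<open>d\<close>, then
  \<open>d\<close> would be inner and \<open>2 * (m + 1) = m + 2\<close>. So one of them stops,
  which fixes both weights, and \<open>branch_E8\<close> excludes \<open>m \<ge> 2\<close>.\<close>

lemma branch:
  fixes m :: int
  assumes t: "lo s = {t}" "up t = {s}" and w: "w s = (m + 1) * u" "w t = m * u"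
    and up_s: "up s = {b, b'}" "b \<noteq> b'" and u: "u > 0" and m: "m \<ge> 1"
  shows "m = 1 \<and> (w b = 2 * u \<and> w b' = u \<or> w b = u \<and> w b' = 2 * u)"
proof -
  have lo: "lo b = {s}" "lo b' = {s}" using chain_step[OF t] up_s by auto
  have sP: "s \<in> P" using sibling_join[OF up_s] by simp
  have "sg s = {b, b'}" using sg_up[of s] up_s lo by (auto simp: sg_def)
  then have sum: "w b + w b' = (m + 2) * u"
    using balance[OF sP] t w up_s(2) by (simp add: algebra_simps)
  define d where "d = jn b b'"
  have d: "lo d = {b, b'}" "w d = (m + 1) * u" "d \<in> P"
    using sibling_join[OF up_s] w d_def loD[of b d] by simp_all
  have mu: "m * u > 0" using m u by simp
  have Eb: "(2 * w b = (m + 1) * u \<and> up b = {d}) \<or> (\<exists>q. q \<noteq> d \<and> up b = {d, q})"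
    using up_end1[OF lo(1) up_s] w d_def by auto
  have Eb': "(2 * w b' = (m + 1) * u \<and> up b' = {d}) \<or> (\<exists>q. q \<noteq> d \<and> up b' = {d, q})"
    using up_end1[OF lo(2), of b] up_s w d_def by (auto simp: insert_commute jn_commute)
  have "\<not> ((\<exists>q. q \<noteq> d \<and> up b = {d, q}) \<and> (\<exists>q. q \<noteq> d \<and> up b' = {d, q}))"
  proof (rule notI, elim conjE exE)
    fix e e' assume "e \<noteq> d" "up b = {d, e}" "e' \<noteq> d" "up b' = {d, e'}"
    then have "2 * w d = w b + w b'" using up_inner(1)[of d b b' e e'] d up_s by auto
    then show False using d sum mu by (auto simp: algebra_simps)
  qed
  then consider "2 * w b = (m + 1) * u" "up b = {d}" | "2 * w b' = (m + 1) * u" "up b' = {d}"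
    using Eb Eb' by blast
  then show ?thesis
  proof cases
    case 1
    then have "2 * w b' = (m + 3) * u" using sum by (simp add: algebra_simps)
    moreover have "up s = {b', b}" "b' \<noteq> b" using up_s by auto
    ultimately have "\<not> m \<ge> 2"
      using branch_E8[of s b' b m u] lo w u 1 by (auto simp: d_def jn_commute)
    then have "m = 1" using m by simp
    then show ?thesis using 1 sum by simp
  next
    case 2
    then have "2 * w b = (m + 3) * u" using sum by (simp add: algebra_simps)
    then have "\<not> m \<ge> 2"
      using branch_E8[of s b b' m u] lo w u up_s 2 by (auto simp: d_def)
    then have "m = 1" using m by simp
    then show ?thesis using 2 sum by simp
  qed
qed

end

section \<open>Coordinates\<close>

definition lower_nbrs :: "(nat \<times> nat) set \<Rightarrow> nat \<times> nat \<Rightarrow> (nat \<times> nat) set" where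
  "lower_nbrs Q q = {u \<in> Q. q = (Suc (fst u), snd u) \<or> q = (fst u, Suc (snd u))}"

definition upper_nbrs :: "(nat \<times> nat) set \<Rightarrow> nat \<times> nat \<Rightarrow> (nat \<times> nat) set" where
  "upper_nbrs Q q = {v \<in> Q. v = (Suc (fst q), snd q) \<or> v = (fst q, Suc (snd q))}"

text \<open>Adjacent cells on the same antidiagonal: the counterpart of \<open>sib\<close>.\<close>

definition diag_nbrs :: "(nat \<times> nat) set \<Rightarrow> nat \<times> nat \<Rightarrow> (nat \<times> nat) set" where
  "diag_nbrs Q q = {s \<in> Q. (fst s = Suc (fst q) \<and> snd q = Suc (snd s)) \<or> (fst q = Suc (fst s) \<and> snd s = Suc (snd q))}"

abbreviation level :: "nat \<times> nat \<Rightarrow> nat" where "level q \<equiv> fst q + snd q"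

lemma lower_upper: "u \<in> lower_nbrs Q q \<Longrightarrow> q \<in> Q \<Longrightarrow> q \<in> upper_nbrs Q u"
  by (auto simp: lower_nbrs_def upper_nbrs_def)

lemma upper_lower: "u \<in> upper_nbrs Q q \<Longrightarrow> q \<in> Q \<Longrightarrow> q \<in> lower_nbrs Q u"
  by (auto simp: lower_nbrs_def upper_nbrs_def)

lemma lower_nbrs_determine:
  assumes "q \<noteq> s" "q \<in> lower_nbrs Q v" "s \<in> lower_nbrs Q v" "q \<in> lower_nbrs Q v'" "s \<in> lower_nbrs Q v'"
  shows "v = v'"
  using assms by (cases v; cases v'; cases q; cases s) (auto simp: lower_nbrs_def)

lemma lower_level: "u \<in> lower_nbrs Q q \<Longrightarrow> level q = Suc (level u)"
  by (auto simp: lower_nbrs_def)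

lemma upper_level: "u \<in> upper_nbrs Q q \<Longrightarrow> level u = Suc (level q)"
  by (auto simp: upper_nbrs_def)

context differential_poset
begin

text \<open>A point with given lower covers is unique, except where the initial chain branches; there
  \<open>init\<close> prescribes the images.\<close>

function grid_map :: "(nat \<times> nat) set \<Rightarrow> (nat \<times> nat \<Rightarrow> 'a option) \<Rightarrow> nat \<times> nat \<Rightarrow> 'a" where
  "grid_map Q init q = (case init q of Some p \<Rightarrow> p
     | None \<Rightarrow> (SOME p. p \<in> P \<and> lo p = grid_map Q init ` lower_nbrs Q q))"
  by pat_completeness auto
termination
  by (relation "measure (\<lambda>(Q, init, q). level q)") (auto dest: lower_level)

declare grid_map.simps [simp del]

lemma grid_map_Some: "init q = Some p \<Longrightarrow> grid_map Q init q = p"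
  by (subst grid_map.simps) simp

lemma grid_map_eqI:
  assumes "init v = None" "x \<in> P" "lo x = grid_map Q init ` lower_nbrs Q v"
    and "\<And>y. y \<in> P \<Longrightarrow> lo y = grid_map Q init ` lower_nbrs Q v \<Longrightarrow> y = x"
  shows "grid_map Q init v = x"
proof -
  have "grid_map Q init v = (SOME p. p \<in> P \<and> lo p = grid_map Q init ` lower_nbrs Q v)"
    by (subst grid_map.simps) (simp add: assms(1))
  also have "\<dots> = x" by (rule some_equality) (use assms(2-4) in blast)+
  finally show ?thesis .
qed

text \<open>The join with the sibling takes one of the at most two upper covers.\<close>

lemma sg_unique: "\<lbrakk>t \<in> sg p; t' \<in> sg p; a \<in> sib p\<rbrakk> \<Longrightarrow> t = t'"
proof (rule ccontr)
  assume h: "t \<in> sg p" "t' \<in> sg p" "a \<in> sib p" "t \<noteq> t'"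
  then have "up p = {t, t'}" using up_pair sg_up by blast
  moreover have "jn p a \<in> up p" "jn p a \<notin> sg p" using sibD[OF h(3)] by (auto simp: sg_def)
  ultimately show False using h by auto
qed

end

section \<open>Identifying the poset with a weighted region of the grid\<close>

text \<open>A common frame for all model regions. \<open>corner\<close>, \<open>wt_balance\<close>
  and \<open>wt_pos\<close> state for \<open>Q\<close> the facts proved for \<open>P\<close>.
  \<open>base\<close> treats cells without a diagonal neighbour, where no sibling helps to determine
  the upper covers, and \<open>init\<close> confines prescribed images to cells whose lower cells
  are of this kind.\<close>

locale grid = differential_poset +
  fixes Q :: "(nat \<times> nat) set" and wt :: "nat \<times> nat \<Rightarrow> int"
    and init :: "nat \<times> nat \<Rightarrow> 'a option"
  assumes origin: "(0, 0) \<in> Q" "wt (0, 0) = r" "init (0, 0) = None"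
    and lower_nonempty: "q \<in> Q \<Longrightarrow> q \<noteq> (0, 0) \<Longrightarrow> lower_nbrs Q q \<noteq> {}"
    and corner: "(Suc x, y) \<in> Q \<Longrightarrow> (x, Suc y) \<in> Q \<Longrightarrow>
      (x, y) \<in> Q \<and> (Suc x, Suc y) \<in> Q \<and> wt (Suc x, Suc y) = wt (x, y)"
    and wt_pos: "q \<in> Q \<Longrightarrow> wt q > 0"
    and wt_balance: "q \<in> Q \<Longrightarrow>
      2 * wt q = sum wt (lower_nbrs Q q) + sum wt {u \<in> upper_nbrs Q q. lower_nbrs Q u = {q}}"
    and init: "init q \<noteq> None \<Longrightarrow> u \<in> lower_nbrs Q q \<Longrightarrow> diag_nbrs Q u = {}"
    and base: "q \<in> Q \<Longrightarrow> diag_nbrs Q q = {} \<Longrightarrow>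
      (\<And>q'. q' \<in> Q \<Longrightarrow> level q' \<le> level q \<Longrightarrow>
         grid_map Q init q' \<in> P \<and> lo (grid_map Q init q') = grid_map Q init ` lower_nbrs Q q' \<and>
         w (grid_map Q init q') = wt q') \<Longrightarrow>
      up (grid_map Q init q) = grid_map Q init ` upper_nbrs Q q \<and>
      inj_on (grid_map Q init) (upper_nbrs Q q) \<and>
      (\<forall>v\<in>upper_nbrs Q q. grid_map Q init v \<in> P \<and>
         lo (grid_map Q init v) = grid_map Q init ` lower_nbrs Q v \<and> w (grid_map Q init v) = wt v)"
    and convex: "q \<in> Q \<Longrightarrow> q' \<in> Q \<Longrightarrow> q \<le> q' \<Longrightarrow> q \<noteq> q' \<Longrightarrow> \<exists>v\<in>upper_nbrs Q q. v \<le> q'"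
begin

abbreviation f :: "nat \<times> nat \<Rightarrow> 'a" where "f \<equiv> grid_map Q init"

text \<open>\<open>placed\<close> says that the map is right at \<open>q\<close> looking down,
  \<open>complete\<close> that it is right looking up; both are proved together, level by
  level.\<close>

definition placed :: "nat \<times> nat \<Rightarrow> bool" where
  "placed q \<longleftrightarrow> f q \<in> P \<and> lo (f q) = f ` lower_nbrs Q q \<and> w (f q) = wt q"

definition complete :: "nat \<times> nat \<Rightarrow> bool" where
  "complete q \<longleftrightarrow> up (f q) = f ` upper_nbrs Q q \<and> inj_on f (upper_nbrs Q q) \<and>
     (\<forall>v\<in>upper_nbrs Q q. placed v)"

lemma placed_origin: "placed (0, 0)"
proof -
  obtain z where z: "z \<in> P" "lo z = {}" "w z = r" "\<And>m. m \<in> P \<Longrightarrow> lo m = {} \<Longrightarrow> m = z"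
    using bottom by blast
  have e: "lower_nbrs Q (0, 0) = {}" by (auto simp: lower_nbrs_def)
  have "f (0, 0) = z"
    by (rule grid_map_eqI[of init "(0, 0)" z Q, OF origin(3) z(1)]) (use z(2,4) e in simp_all)
  then show ?thesis using z(1-3) e origin(2) by (simp add: placed_def)
qed

text \<open>\<open>corner\<close> in symmetric form, for either orientation of the antidiagonal
  step.\<close>

lemma diag_square:
  assumes "q \<in> Q" "s \<in> diag_nbrs Q q"
  obtains u v where "u \<in> lower_nbrs Q q" "u \<in> lower_nbrs Q s" "v \<in> upper_nbrs Q q" "wt v = wt u"
    "lower_nbrs Q v = {q, s}" "q \<in> upper_nbrs Q u" "s \<in> upper_nbrs Q u" "q \<noteq> s" "s \<in> Q"
proof -
  obtain x y where "(q = (Suc x, y) \<and> s = (x, Suc y)) \<or> (s = (Suc x, y) \<and> q = (x, Suc y))"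
    using assms(2) by (cases q; cases s) (auto simp: diag_nbrs_def)
  moreover have "s \<in> Q" using assms by (simp add: diag_nbrs_def)
  moreover from calculation have c: "(x, y) \<in> Q" "(Suc x, Suc y) \<in> Q" "wt (Suc x, Suc y) = wt (x, y)"
    "(Suc x, y) \<in> Q" "(x, Suc y) \<in> Q"
    using corner[of x y] assms(1) by auto
  have "lower_nbrs Q (Suc x, Suc y) = {(Suc x, y), (x, Suc y)}"
    using c by (auto simp: lower_nbrs_def)
  moreover have "(x, y) \<in> lower_nbrs Q (Suc x, y)" "(x, y) \<in> lower_nbrs Q (x, Suc y)"
    using c by (simp_all add: lower_nbrs_def)
  moreover have "(Suc x, Suc y) \<in> upper_nbrs Q (Suc x, y)" "(Suc x, Suc y) \<in> upper_nbrs Q (x, Suc y)"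
    "(Suc x, y) \<in> upper_nbrs Q (x, y)" "(x, Suc y) \<in> upper_nbrs Q (x, y)"
    using c by (simp_all add: upper_nbrs_def)
  moreover note c
  ultimately show thesis
    by (elim disjE conjE; intro that[of "(x, y)" "(Suc x, Suc y)"]; simp add: insert_commute)
qed

lemma diag_of_lower:
  assumes "u \<in> lower_nbrs Q q" "v \<in> upper_nbrs Q u" "v \<noteq> q" "q \<in> Q"
  shows "v \<in> diag_nbrs Q q"
  using assms by (auto simp: lower_nbrs_def upper_nbrs_def diag_nbrs_def)

lemma diag_of_upper:
  assumes "v \<in> upper_nbrs Q q" "q \<in> Q" "lower_nbrs Q v \<noteq> {q}"
  obtains s where "s \<in> diag_nbrs Q q" "lower_nbrs Q v = {q, s}"
proof -
  obtain s where s: "s \<in> lower_nbrs Q v" "s \<noteq> q"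
    using assms upper_lower by blast
  have "q \<in> lower_nbrs Q v" using upper_lower assms by blast
  then have "lower_nbrs Q v = {q, s}"
    using s by (cases v; cases q; cases s) (auto simp: lower_nbrs_def)
  moreover have "s \<in> diag_nbrs Q q"
    using s \<open>q \<in> lower_nbrs Q v\<close> by (cases v; cases q; cases s) (auto simp: lower_nbrs_def diag_nbrs_def)
  ultimately show thesis using that by blast
qed

text \<open>In \<open>P\<close> and in \<open>Q\<close> the upper covers are the joins with siblings
  and at most one single cover. Joins correspond through squares; single covers have equal total
  weight by the two balance equations, so positivity matches their existence.\<close>

lemma complete_step:
  assumes q: "q \<in> Q" and ne: "diag_nbrs Q q \<noteq> {}"
    and pl: "\<And>q'. q' \<in> Q \<Longrightarrow> level q' \<le> level q \<Longrightarrow> placed q'"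
    and co: "\<And>q'. q' \<in> Q \<Longrightarrow> level q' < level q \<Longrightarrow> complete q'"
  shows "complete q"
proof -
  let ?p = "f q"
  let ?SG = "{u \<in> upper_nbrs Q q. lower_nbrs Q u = {q}}"
  have p: "?p \<in> P" "lo ?p = f ` lower_nbrs Q q" "w ?p = wt q"
    using pl[OF q] by (auto simp: placed_def)
  have low: "u \<in> Q" "complete u" "placed u" "q \<in> upper_nbrs Q u" if "u \<in> lower_nbrs Q q" for u
    using that lower_level[OF that] co[of u] pl[of u] lower_upper[OF that q]
    by (auto simp: lower_nbrs_def)
  \<comment> \<open>Siblings are reached through a lower cover, and the lower cells are already
    complete.\<close>
  have sib_p: "sib ?p = f ` diag_nbrs Q q"
  proof (intro equalityI subsetI)
    fix a assume "a \<in> sib ?p"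
    then obtain u where u: "u \<in> lower_nbrs Q q" "a \<in> up (f u)" "a \<noteq> ?p"
      unfolding sib_def p(2) by auto
    have "up (f u) = f ` upper_nbrs Q u" using low(2)[OF u(1)] by (simp add: complete_def)
    then obtain v where v: "v \<in> upper_nbrs Q u" "a = f v" using u by blast
    then have "v \<in> diag_nbrs Q q" using diag_of_lower[OF u(1)] u q by blast
    then show "a \<in> f ` diag_nbrs Q q" using v by blast
  next
    fix a assume "a \<in> f ` diag_nbrs Q q"
    then obtain s where s: "s \<in> diag_nbrs Q q" "a = f s" by auto
    obtain u v where u: "u \<in> lower_nbrs Q q" "q \<in> upper_nbrs Q u" "s \<in> upper_nbrs Q u" "q \<noteq> s"
      using diag_square[OF q s(1)] .
    have "f s \<noteq> f q" "f s \<in> up (f u)"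
      using low(2)[OF u(1)] u by (auto simp: complete_def inj_on_eq_iff)
    then show "a \<in> sib ?p" using u(1) s(2) unfolding sib_def p(2) by auto
  qed
  \<comment> \<open>Two lower cells of \<open>q\<close> are diagonal neighbours, so they lie above a
    common cell whose completeness separates their images.\<close>
  have inj_low: "inj_on f (lower_nbrs Q q)"
  proof (rule inj_onI, rule ccontr)
    fix u u' assume h: "u \<in> lower_nbrs Q q" "u' \<in> lower_nbrs Q q" "f u = f u'" "u \<noteq> u'"
    then have "u' \<in> diag_nbrs Q u" "u \<in> Q"
      by (cases q; cases u; cases u'; auto simp: lower_nbrs_def diag_nbrs_def)+
    then obtain z where z: "z \<in> lower_nbrs Q u" "u \<in> upper_nbrs Q z" "u' \<in> upper_nbrs Q z"
      using diag_square by metis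
    have "z \<in> Q" "level z < level q"
      using z lower_level[OF z(1)] lower_level[OF h(1)] by (auto simp: lower_nbrs_def)
    then have "inj_on f (upper_nbrs Q z)" using co by (simp add: complete_def)
    then show False using z h by (auto simp: inj_on_def)
  qed
  \<comment> \<open>A cell above \<open>q\<close> has no prescribed image because \<open>q\<close>
    has a diagonal neighbour, so \<open>f v\<close> is the unique point with lower covers
    \<open>{?p, f s}\<close>.\<close>
  have square: "v \<in> upper_nbrs Q q \<Longrightarrow> lower_nbrs Q v = {q, s} \<Longrightarrow> s \<in> diag_nbrs Q q \<Longrightarrow>
      placed v \<and> f v = jn ?p (f s) \<and> f s \<noteq> ?p" for v s
  proof -
    assume v: "v \<in> upper_nbrs Q q" "lower_nbrs Q v = {q, s}" and s: "s \<in> diag_nbrs Q q"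
    obtain u v' where u: "u \<in> lower_nbrs Q q" "u \<in> lower_nbrs Q s" "q \<in> upper_nbrs Q u" "s \<in> upper_nbrs Q u"
      "q \<noteq> s" "s \<in> Q" and v': "v' \<in> upper_nbrs Q q" "wt v' = wt u" "lower_nbrs Q v' = {q, s}"
      using diag_square[OF q s] .
    have vv: "v' = v" using lower_nbrs_determine[OF u(5), of Q v' v] v v' by simp
    have pls: "placed s" using pl[OF u(6)] lower_level u by (metis order_refl)
    have f_ne: "?p \<noteq> f s" using low(2)[OF u(1)] u by (auto simp: complete_def inj_on_eq_iff)
    have fu: "f u \<in> lo ?p" "f u \<in> lo (f s)" using p u pls by (auto simp: placed_def)
    note j = jn[OF f_ne fu]
    have fl: "f ` lower_nbrs Q v = {?p, f s}" using v by simp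
    have "init v = None" using init[of v q] ne v by auto
    moreover have jP: "jn ?p (f s) \<in> P" using j(4) upD by blast
    ultimately have fv: "f v = jn ?p (f s)"
      by (rule grid_map_eqI) (simp only: fl j(1), rule j(3), simp only: fl)
    then show "placed v \<and> f v = jn ?p (f s) \<and> f s \<noteq> ?p"
      using j(1,2) jP fl f_ne low(3)[OF u(1)] v'(2) vv by (simp add: placed_def)
  qed
  have jn_img: "jn ?p ` sib ?p = f ` (upper_nbrs Q q - ?SG)"
  proof (intro equalityI subsetI)
    fix x assume "x \<in> jn ?p ` sib ?p"
    then obtain s where s: "s \<in> diag_nbrs Q q" "x = jn ?p (f s)" using sib_p by auto
    obtain u v where v: "v \<in> upper_nbrs Q q" "lower_nbrs Q v = {q, s}" "q \<noteq> s"
      using diag_square[OF q s(1)] .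
    have "x = f v" using square[OF v(1,2) s(1)] s(2) by simp
    moreover have "v \<in> upper_nbrs Q q - ?SG" using v by auto
    ultimately show "x \<in> f ` (upper_nbrs Q q - ?SG)" by blast
  next
    fix x assume "x \<in> f ` (upper_nbrs Q q - ?SG)"
    then obtain v where v: "v \<in> upper_nbrs Q q" "lower_nbrs Q v \<noteq> {q}" "x = f v" by auto
    obtain s where s: "s \<in> diag_nbrs Q q" "lower_nbrs Q v = {q, s}" using diag_of_upper[OF v(1) q v(2)] .
    then have "x = jn ?p (f s)" using square[OF v(1) s(2,1)] v by simp
    then show "x \<in> jn ?p ` sib ?p" using s(1) sib_p by blast
  qed
  have "sum w (lo ?p) = sum wt (lower_nbrs Q q)"
    unfolding p(2) by (subst sum.reindex[OF inj_low]) (use low(3) in \<open>auto simp: placed_def intro!: sum.cong\<close>)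
  then have sum_sg: "sum w (sg ?p) = sum wt ?SG"
    using balance[OF p(1)] wt_balance[OF q] p(3) by simp
  obtain s0 where s0: "s0 \<in> diag_nbrs Q q" using ne by auto
  then have sib0: "f s0 \<in> sib ?p" using sib_p by auto
  obtain u0 v0 where v0: "v0 \<in> upper_nbrs Q q" "lower_nbrs Q v0 = {q, s0}" "q \<noteq> s0"
    using diag_square[OF q s0] .
  \<comment> \<open>The square on \<open>q\<close> and \<open>s0\<close> takes one of the at most
    two upper cells.\<close>
  have SG_unique: "v = v'" if "v \<in> ?SG" "v' \<in> ?SG" for v v'
    using that v0 by (auto simp: upper_nbrs_def)
  have sg_img: "sg ?p = f ` ?SG \<and> (\<forall>v\<in>?SG. placed v)"
  proof (cases "?SG = {}")
    case True
    have "sg ?p = {}"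
    proof (rule ccontr)
      assume "sg ?p \<noteq> {}"
      moreover have "w t > 0" if "t \<in> sg ?p" for t using that sg_up upD w_pos by blast
      ultimately have "sum w (sg ?p) > 0" using finite_sg[OF p(1)] by (intro sum_pos) auto
      then show False using sum_sg True by simp
    qed
    then show ?thesis unfolding True by simp
  next
    case False
    then obtain v where v: "v \<in> ?SG" by auto
    then have SG: "?SG = {v}" using SG_unique by blast
    have vQ: "v \<in> Q" using v by (simp add: upper_nbrs_def)
    have s: "sum w (sg ?p) = wt v" using sum_sg SG by simp
    then have "sg ?p \<noteq> {}" using wt_pos[OF vQ] by force
    then obtain t where t: "t \<in> sg ?p" by auto
    then have sg: "sg ?p = {t}" using sg_unique[OF _ _ sib0] by blast
    have "t \<in> P" using t sg_up upD by blast
    then have lot: "lo t = {?p}" "t \<in> P" "w t = wt v" using t s sg by (simp_all add: sg_def)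
    have lv: "f ` lower_nbrs Q v = {?p}" using v by simp
    have "init v = None" using init[of v q] ne v by auto
    then have "f v = t"
      by (rule grid_map_eqI) (use lot lv sg in \<open>auto simp: sg_def\<close>)
    then show ?thesis using SG sg lot lv by (auto simp: placed_def)
  qed
  \<comment> \<open>If two diagonal neighbours had the same image, that image and \<open>?p\<close>
    would share two distinct lower covers.\<close>
  have inj_diag: "inj_on f (diag_nbrs Q q)"
  proof (rule inj_onI, rule ccontr)
    fix s s' assume h: "s \<in> diag_nbrs Q q" "s' \<in> diag_nbrs Q q" "f s = f s'" "s \<noteq> s'"
    obtain u v where u: "u \<in> lower_nbrs Q q" "u \<in> lower_nbrs Q s" "q \<in> upper_nbrs Q u" "s \<in> upper_nbrs Q u"
      "q \<noteq> s" "s \<in> Q" using diag_square[OF q h(1)] .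
    obtain u' v' where u': "u' \<in> lower_nbrs Q q" "u' \<in> lower_nbrs Q s'" "s' \<in> Q"
      using diag_square[OF q h(2)] .
    have "u \<noteq> u'" using h u u' by (cases q; cases s; cases s'; cases u; cases u') (auto simp: lower_nbrs_def diag_nbrs_def)
    then have fu: "f u \<noteq> f u'" using inj_low u u' by (auto simp: inj_on_def)
    have lev: "level s = level q" "level s' = level q" using h by (auto simp: diag_nbrs_def)
    have "placed s" "placed s'" using pl u(6) u'(3) lev by auto
    then have "f u \<in> lo (f s)" "f u' \<in> lo (f s)" "f u \<in> lo ?p" "f u' \<in> lo ?p"
      using u u' h p by (auto simp: placed_def)
    moreover have "f s \<noteq> ?p" using low(2)[OF u(1)] u by (auto simp: complete_def inj_on_eq_iff)
    ultimately show False using lo_unique[of "f s" ?p] fu by blast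
  qed
  have placed_upper: "placed v" if v: "v \<in> upper_nbrs Q q" for v
  proof (cases "lower_nbrs Q v = {q}")
    case True
    then show ?thesis using v sg_img by blast
  next
    case False
    then obtain s where "s \<in> diag_nbrs Q q" "lower_nbrs Q v = {q, s}" using diag_of_upper[OF v q] by blast
    then show ?thesis using square[OF v] by blast
  qed
  have inj: "inj_on f (upper_nbrs Q q)"
  proof (rule inj_onI)
    fix v v' assume h: "v \<in> upper_nbrs Q q" "v' \<in> upper_nbrs Q q" "f v = f v'"
    have eq: "f ` lower_nbrs Q v = f ` lower_nbrs Q v'"
      using placed_upper[OF h(1)] placed_upper[OF h(2)] h(3) by (simp add: placed_def)
    have single: "lower_nbrs Q x = {q}" if x: "x \<in> upper_nbrs Q q" and "f ` lower_nbrs Q x = {?p}" for x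
    proof (rule ccontr)
      assume "lower_nbrs Q x \<noteq> {q}"
      then obtain s where "s \<in> diag_nbrs Q q" "lower_nbrs Q x = {q, s}" using diag_of_upper[OF x q] by blast
      then show False using square[OF x] that(2) by auto
    qed
    show "v = v'"
    proof (cases "lower_nbrs Q v = {q}")
      case True
      then have "lower_nbrs Q v' = {q}" using single[OF h(2)] eq by simp
      then show ?thesis using SG_unique True h by simp
    next
      case False
      then obtain s where s: "s \<in> diag_nbrs Q q" "lower_nbrs Q v = {q, s}"
        using diag_of_upper[OF h(1) q] by blast
      have "lower_nbrs Q v' \<noteq> {q}" using single[OF h(1)] eq False by auto
      then obtain s' where s': "s' \<in> diag_nbrs Q q" "lower_nbrs Q v' = {q, s'}"
        using diag_of_upper[OF h(2) q] by blast
      have "f s \<noteq> ?p" "f s' \<noteq> ?p" using square s s' h by blast+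
      then have "f s = f s'" using eq s s' by (simp add: doubleton_eq_iff)
      then have "s = s'" using inj_diag s s' by (simp add: inj_on_eq_iff)
      moreover have "q \<noteq> s" using s by (auto simp: diag_nbrs_def)
      ultimately show ?thesis using lower_nbrs_determine[of q s Q v v'] s s' by simp
    qed
  qed
  have "up ?p = f ` upper_nbrs Q q" using up_eq[of ?p] sg_img jn_img by blast
  then show ?thesis using inj placed_upper by (simp add: complete_def)
qed

text \<open>Completeness at level \<open>n\<close> places the cells of level \<open>Suc n\<close>,
  since each of them has a lower cell.\<close>

lemma complete_level:
  "(\<forall>q\<in>Q. level q \<le> n \<longrightarrow> placed q) \<and> (\<forall>q\<in>Q. level q < n \<longrightarrow> complete q)"
proof (induction n)
  case 0
  show ?case using placed_origin by (auto simp: split_paired_all)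
next
  case (Suc n)
  have co: "complete q" if "q \<in> Q" "level q \<le> n" for q
  proof (cases "diag_nbrs Q q = {}")
    case True
    show ?thesis unfolding complete_def placed_def
      by (rule base[OF that(1) True]) (use Suc that in \<open>auto simp: placed_def\<close>)
  next
    case False
    show ?thesis by (rule complete_step[OF that(1) False]) (use Suc that in auto)
  qed
  have "placed q" if "q \<in> Q" "level q = Suc n" for q
  proof -
    have "q \<noteq> (0, 0)" using that by auto
    then obtain u where u: "u \<in> lower_nbrs Q q" using lower_nonempty[OF \<open>q \<in> Q\<close>] by blast
    then have "complete u" using co[of u] lower_level[OF u] that by (simp add: lower_nbrs_def)
    then show ?thesis using lower_upper[OF u that(1)] by (simp add: complete_def)
  qed
  then show ?case using co Suc by (simp add: le_Suc_eq less_Suc_eq_le)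
qed

lemma complete: "q \<in> Q \<Longrightarrow> complete q"
  using complete_level[of "Suc (level q)"] by simp

lemma placed: "q \<in> Q \<Longrightarrow> f q \<in> P" "q \<in> Q \<Longrightarrow> lo (f q) = f ` lower_nbrs Q q" "q \<in> Q \<Longrightarrow> w (f q) = wt q"
  using complete_level[of "level q"] by (auto simp: placed_def)

text \<open>A point covering an already reached \<open>f u\<close> is found among its upper covers,
  which completeness lists.\<close>

lemma f_surj: "p \<in> P \<Longrightarrow> p \<in> f ` Q"
proof (induction p rule: below_induct)
  case (less p)
  show ?case
  proof (cases "lo p = {}")
    case True
    have "f (0, 0) = p"
      using bottom_unique[OF _ _ less.hyps True] placed(1,2)[OF origin(1)]
      by (auto simp: lower_nbrs_def)
    then show ?thesis using origin by blast
  next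
    case False
    then obtain c where c: "c \<in> lo p" by auto
    then obtain u where u: "u \<in> Q" "c = f u" using less.IH[of c] loD by blast
    then have "p \<in> f ` upper_nbrs Q u" using complete[of u] c by (simp add: complete_def lo_up)
    then show ?thesis by (auto simp: upper_nbrs_def)
  qed
qed

lemma f_inj: "q \<in> Q \<Longrightarrow> q' \<in> Q \<Longrightarrow> f q = f q' \<Longrightarrow> q = q'"
proof (induction "level q" arbitrary: q q' rule: less_induct)
  case less
  have eq: "f ` lower_nbrs Q q = f ` lower_nbrs Q q'" using placed(2) less.prems by metis
  show ?case
  proof (cases "q = (0, 0)")
    case True
    then have "lower_nbrs Q q' = {}" using eq by (auto simp: lower_nbrs_def)
    then show ?thesis using lower_nonempty[OF less.prems(2)] True by blast
  next
    case False
    then obtain u where u: "u \<in> lower_nbrs Q q" using lower_nonempty less.prems by blast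
    then obtain u' where u': "u' \<in> lower_nbrs Q q'" "f u = f u'" using eq by blast
    have Q: "u \<in> Q" "u' \<in> Q" using u u' by (auto simp: lower_nbrs_def)
    then have "u = u'" using less.hyps[of u u'] lower_level[OF u] u' by simp
    then have "q \<in> upper_nbrs Q u" "q' \<in> upper_nbrs Q u" using lower_upper u u' less.prems by auto
    then show ?thesis using complete[OF Q(1)] less.prems(3) by (auto simp: complete_def inj_on_def)
  qed
qed

text \<open>Climbs from \<open>q\<close> to \<open>q'\<close> by single steps inside
  \<open>Q\<close>, which \<open>convex\<close> provides.\<close>

lemma f_mono: "q \<in> Q \<Longrightarrow> q' \<in> Q \<Longrightarrow> q \<le> q' \<Longrightarrow> f q \<le> f q'"
proof (induction "level q' - level q" arbitrary: q rule: less_induct)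
  case less
  show ?case
  proof (cases "q = q'")
    case False
    then obtain v where v: "v \<in> upper_nbrs Q q" "v \<le> q'" using convex less.prems by blast
    have vQ: "v \<in> Q" using v by (simp add: upper_nbrs_def)
    have "level v \<le> level q'" using v by (auto simp: less_eq_prod_def intro: add_mono)
    then have "f v \<le> f q'" using less.hyps[of v] upper_level[OF v(1)] vQ less.prems v by simp
    moreover have "f v \<in> up (f q)" using complete[OF less.prems(1)] v by (simp add: complete_def)
    ultimately show ?thesis using upD by (metis less_imp_le order.trans)
  qed simp
qed

text \<open>Descends from \<open>f q'\<close> along lower covers, which \<open>placed\<close>
  identifies with lower cells.\<close>

lemma f_mono_rev: "q' \<in> Q \<Longrightarrow> q \<in> Q \<Longrightarrow> f q \<le> f q' \<Longrightarrow> q \<le> q'"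
proof (induction "level q'" arbitrary: q' rule: less_induct)
  case less
  show ?case
  proof (cases "f q = f q'")
    case True
    then show ?thesis using f_inj less.prems by blast
  next
    case False
    then obtain c where c: "c \<in> lo (f q')" "f q \<le> c"
      using ex_lo_between[of "f q" "f q'"] placed(1) less.prems by (metis order_le_less)
    then obtain u where u: "u \<in> lower_nbrs Q q'" "c = f u" using placed(2) less.prems by auto
    then have "q \<le> u" using less.hyps[of u] lower_level[OF u(1)] c less.prems by (simp add: lower_nbrs_def)
    moreover have "u \<le> q'" using u by (auto simp: lower_nbrs_def less_eq_prod_def)
    ultimately show ?thesis by (rule order.trans)
  qed
qed

lemma ex_iso: "\<exists>\<phi>. order_iso \<phi> P (\<le>) (map_prod int int ` Q) (\<le>) \<and>
   (\<forall>p\<in>P. \<exists>x y. (x, y) \<in> Q \<and> \<phi> p = (int x, int y) \<and> w p = wt (x, y))"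
proof -
  define g where "g = inv_into Q f"
  have inj: "inj_on f Q" using f_inj by (auto simp: inj_on_def)
  have im: "f ` Q = P" using f_surj placed(1) by auto
  have g: "g p \<in> Q" "f (g p) = p" if "p \<in> P" for p
    using that im unfolding g_def by (auto intro: inv_into_into f_inv_into_f)
  have bg: "bij_betw g P Q"
    unfolding g_def by (rule bij_betw_inv_into) (simp add: bij_betw_def inj im)
  have bm: "bij_betw (map_prod int int) Q (map_prod int int ` Q)"
    by (rule inj_on_imp_bij_betw) (auto simp: inj_on_def)
  have le: "map_prod int int a \<le> map_prod int int b \<longleftrightarrow> a \<le> b" for a b
    by (cases a; cases b) (simp add: less_eq_prod_def)
  have "p \<le> p' \<longleftrightarrow> g p \<le> g p'" if "p \<in> P" "p' \<in> P" for p p'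
    using f_mono[of "g p" "g p'"] f_mono_rev[of "g p'" "g p"] g that by auto
  then have "order_iso (map_prod int int \<circ> g) P (\<le>) (map_prod int int ` Q) (\<le>)"
    using bij_betw_trans[OF bg bm] by (simp add: order_iso_def le)
  moreover have "\<exists>x y. (x, y) \<in> Q \<and> (map_prod int int \<circ> g) p = (int x, int y) \<and> w p = wt (x, y)"
    if "p \<in> P" for p
    using g[OF that] placed(3)[OF g(1)[OF that]] by (cases "g p") auto
  ultimately show ?thesis by blast
qed

end

section \<open>Classification of the poset of points\<close>

lemma mem_image_int: "(u, v) \<in> map_prod int int ` Q \<longleftrightarrow> 0 \<le> u \<and> 0 \<le> v \<and> (nat u, nat v) \<in> Q"
proof
  assume "0 \<le> u \<and> 0 \<le> v \<and> (nat u, nat v) \<in> Q"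
  then show "(u, v) \<in> map_prod int int ` Q"
    by (intro image_eqI[of _ _ "(nat u, nat v)"]) auto
qed auto

lemma filter_two:
  assumes "M a \<longleftrightarrow> A" "c \<Longrightarrow> M b \<longleftrightarrow> B"
  shows "{u \<in> {a} \<union> (if c then {b} else {}). M u} = (if A then {a} else {}) \<union> (if B \<and> c then {b} else {})"
  using assms by auto

context differential_poset
begin

section \<open>The model regions: quadrant and strips, octant, single row\<close>

lemma up_eq_sg: "lo p = {} \<Longrightarrow> up p = sg p"
  using up_eq[of p] by (auto simp: sib_def)

text \<open>Along the edge above \<open>b\<close> every point has one lower cover, and
  \<open>up_end1\<close> continues the weights \<open>r, r - t, r - 2 * t, ...\<close>
  arithmetically. Positivity makes the edge stop, and it can stop only where the next weight would
  be exactly \<open>0\<close>.\<close>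

lemma corner_region:
  assumes z: "lo z = {}" and up_z: "up z = {a, b}" "a \<noteq> b" and w: "w a = r + t" "w b = r - t" and t: "t > 0"
  obtains k where "k \<ge> 1" "r = int k * t"
proof -
  have lo_b: "lo b = {z}" using up_eq_sg[OF z] up_z by (auto simp: sg_def)
  have wz: "w z = r" using bottom bottom_unique z sibling_join[OF up_z] by metis
  have bP: "b \<in> P" using sibling_join[OF up_z] by simp
  have chain: "\<exists>p c p'. lo p = {c} \<and> up c = {p, p'} \<and> p \<noteq> p' \<and> w p = r - int (Suc i) * t \<and> w c = r - int i * t"
    if "int (Suc i) * t < r" for i
    using that
  proof (induction i)
    case 0
    have "up z = {b, a}" using up_z by auto
    then show ?case using lo_b up_z(2) w wz by (intro exI[of _ b] exI[of _ z] exI[of _ a]) simp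
  next
    case (Suc i)
    then have "int (Suc i) * t < r" using t by (simp add: algebra_simps)
    then obtain p c p' where p: "lo p = {c}" "up c = {p, p'}" "p \<noteq> p'"
      "w p = r - int (Suc i) * t" "w c = r - int i * t" using Suc.IH by blast
    have "2 * w p - w c = r - int (Suc (Suc i)) * t" using p by (simp add: algebra_simps)
    then obtain q where "q \<noteq> jn p p'" "up p = {jn p p', q}" "lo q = {p}" "w q = r - int (Suc (Suc i)) * t"
      using up_end1[OF p(1-3)] Suc.prems by auto
    moreover from this have "up p = {q, jn p p'}" by auto
    ultimately show ?case using p(4) by blast
  qed
  \<comment> \<open>The largest \<open>i\<close> with \<open>i * t < r\<close>.\<close>
  define i where "i = nat ((r - 1) div t)"
  have "(r - 1) div t \<ge> 0" using t r_pos by (simp add: pos_imp_zdiv_nonneg_iff)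
  then have ii: "int i = (r - 1) div t" by (simp add: i_def)
  define m where "m = (r - 1) mod t"
  have "r - 1 = int i * t + m" unfolding ii m_def by simp
  moreover have "0 \<le> m" "m < t" using t by (simp_all add: m_def)
  ultimately have i: "int i * t < r" "r \<le> int (Suc i) * t" by (simp_all add: algebra_simps)
  have "t < r" using w w_pos[OF bP] by simp
  then have "i \<noteq> 0" using i by (intro notI) simp
  then obtain j where j: "i = Suc j" by (cases i) auto
  obtain p c p' where p: "lo p = {c}" "up c = {p, p'}" "p \<noteq> p'"
      "w p = r - int i * t" "w c = r - int j * t" using chain[of j] i j by blast
  have "2 * w p - w c = r - int (Suc i) * t" using p j by (simp add: algebra_simps)
  \<comment> \<open>The next weight \<open>r - int (Suc i) * t\<close> is not positive, so
    \<open>up_end1\<close> leaves only \<open>2 * w p = w c\<close>.\<close>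
  then have "r = int (Suc i) * t" using up_end1[OF p(1-3)] i by auto
  then show thesis using that[of "Suc i"] by simp
qed

text \<open>The region \<open>int y * t < r\<close> treats two cases at once: \<open>t = 0\<close>
  gives the whole quadrant with constant weight, and \<open>r = int k * t\<close> with
  \<open>t > 0\<close> gives \<open>y < k\<close>.\<close>

lemma two_atoms:
  assumes z: "z \<in> P" "lo z = {}" and up_z: "up z = {a, b}" "a \<noteq> b" and w: "w a = r + t" "w b = r - t"
    and t: "t = 0 \<or> t > 0 \<and> r = int k * t"
  shows "\<exists>\<phi>. order_iso \<phi> P (\<le>) (map_prod int int ` {(x, y). int y * t < r}) (\<le>) \<and>
   (\<forall>p\<in>P. \<exists>x y. \<phi> p = (int x, int y) \<and> w p = r + (int x - int y) * t)"
proof -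
  let ?Q = "{(x, y). int y * t < r}" and ?wt = "\<lambda>(x, y). r + (int x - int y) * t"
  let ?init = "[(Suc 0, 0) \<mapsto> a, (0, Suc 0) \<mapsto> b]"
  let ?f = "grid_map ?Q ?init"
  have lo: "lo a = {z}" "lo b = {z}" using up_eq_sg[OF z(2)] up_z by (auto simp: sg_def)
  have P: "a \<in> P" "b \<in> P" using up_z upD by auto
  have wz: "w z = r" using bottom bottom_unique z by metis
  have t0: "t \<ge> 0" using t by auto
  have tr: "t < r" using w w_pos[OF P(2)] by simp
  have mono: "int y * t < r" if "int (Suc y) * t < r" for y
    using that t0 by (simp add: algebra_simps)
  \<comment> \<open>Above the top row the formula would give weight \<open>0\<close> to the missing
    cell \<open>(0, Suc y)\<close>, which is why balance also holds in that row.\<close>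
  have dvd: "r - (1 + int y) * t = 0" if "int y * t < r" "\<not> int (Suc y) * t < r" for y
  proof -
    have tk: "t > 0" "r = int k * t" using that t r_pos by auto
    then have "int y < int k" "\<not> int (Suc y) < int k" using that by auto
    then have "int k = 1 + int y" by simp
    then show ?thesis using tk by simp
  qed
  have low: "lower_nbrs ?Q (0, 0) = {}"
    "lower_nbrs ?Q (Suc x, 0) = {(x, 0)}"
    "lower_nbrs ?Q (0, Suc y) = (if int y * t < r then {(0, y)} else {})"
    "lower_nbrs ?Q (Suc x, Suc y) = (if int y * t < r then {(Suc x, y)} else {}) \<union> (if int (Suc y) * t < r then {(x, Suc y)} else {})" for x y
    using r_pos by (auto simp: lower_nbrs_def)
  have upp: "upper_nbrs ?Q (x, y) = (if int y * t < r then {(Suc x, y)} else {}) \<union> (if int (Suc y) * t < r then {(x, Suc y)} else {})" for x y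
    by (auto simp: upper_nbrs_def)
  have SG: "{u \<in> upper_nbrs ?Q (x, y). lower_nbrs ?Q u = {(x, y)}} =
      (if y = 0 then {(Suc x, y)} else {}) \<union> (if x = 0 \<and> int (Suc y) * t < r then {(x, Suc y)} else {})"
    if "int y * t < r" for x y
  proof -
    have "lower_nbrs ?Q (Suc x, y) = {(x, y)} \<longleftrightarrow> y = 0"
    proof (cases y)
      case (Suc y')
      then have "int y' * t < r" using that mono[of y'] by simp
      then show ?thesis using Suc that by (simp add: low)
    qed (simp add: low)
    moreover have "lower_nbrs ?Q (x, Suc y) = {(x, y)} \<longleftrightarrow> x = 0" if "int (Suc y) * t < r"
      using that \<open>int y * t < r\<close> by (cases x) (simp_all add: low)
    ultimately show ?thesis unfolding upp if_P[OF that] by (rule filter_two)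
  qed
  have f: "?f (Suc 0, 0) = a" "?f (0, Suc 0) = b"
    by (rule grid_map_Some, simp)+
  interpret grid P w r ?Q ?wt ?init
  proof
    show "(0, 0) \<in> ?Q" "?wt (0, 0) = r" "?init (0, 0) = None" using r_pos by auto
    show "lower_nbrs ?Q q \<noteq> {}" if "q \<in> ?Q" "q \<noteq> (0, 0)" for q
    proof (cases q)
      case (Pair x y)
      then show ?thesis using that mono[of "y - 1"] by (cases x; cases y) (auto simp: low)
    qed
    show "(x, y) \<in> ?Q \<and> (Suc x, Suc y) \<in> ?Q \<and> ?wt (Suc x, Suc y) = ?wt (x, y)"
      if "(Suc x, y) \<in> ?Q" "(x, Suc y) \<in> ?Q" for x y
      using that by simp
    show "?wt q > 0" if "q \<in> ?Q" for q
    proof (cases q)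
      case (Pair x y)
      have "int x * t \<ge> 0" using t0 by simp
      then show ?thesis using that Pair by (simp add: algebra_simps) 
    qed
    show "2 * ?wt q = sum ?wt (lower_nbrs ?Q q) + sum ?wt {u \<in> upper_nbrs ?Q q. lower_nbrs ?Q u = {q}}"
      if "q \<in> ?Q" for q
    proof (cases q)
      case (Pair x y)
      then have y: "int y * t < r" using that by simp
      have "sum ?wt (lower_nbrs ?Q (x, y)) =
          (if x = 0 then 0 else r + (int x - 1 - int y) * t) + (if y = 0 then 0 else r + (int x - int y + 1) * t)"
      proof (cases y)
        case 0
        then show ?thesis by (cases x) (simp_all add: low(1,2))
      next
        case (Suc y')
        then have "int y' * t < r" using mono[of y'] y by simp
        then show ?thesis using Suc y by (cases x) (simp_all add: low(3,4))
      qed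
      moreover have "sum ?wt {u \<in> upper_nbrs ?Q (x, y). lower_nbrs ?Q u = {(x, y)}} =
          (if y = 0 then r + (int x + 1 - int y) * t else 0) +
          (if x = 0 \<and> int (Suc y) * t < r then r + (int x - int y - 1) * t else 0)"
        unfolding SG[OF y] by (simp add: algebra_simps)
      moreover have "int (Suc y) * t < r" if "y = 0" using that tr by simp
      ultimately show ?thesis
        using dvd[OF y] unfolding Pair by (cases "int (Suc y) * t < r"; cases "x = 0"; cases "y = 0") (simp_all add: algebra_simps)
    qed
    show "diag_nbrs ?Q u = {}" if "?init q \<noteq> None" "u \<in> lower_nbrs ?Q q" for q u
    proof -
      have "q = (Suc 0, 0) \<or> q = (0, Suc 0)" using that(1) by (auto split: if_splits)
      then have "u = (0, 0)" using that(2) by (auto simp: lower_nbrs_def)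
      then show ?thesis by (auto simp: diag_nbrs_def)
    qed
    show "\<exists>v\<in>upper_nbrs ?Q q. v \<le> q'" if "q \<in> ?Q" "q' \<in> ?Q" "q \<le> q'" "q \<noteq> q'" for q q'
    proof (cases q)
      case (Pair x y)
      obtain x' y' where q': "q' = (x', y')" by (cases q')
      show ?thesis
      proof (cases "x < x'")
        case True
        then show ?thesis using that Pair q' by (intro bexI[of _ "(Suc x, y)"]) (auto simp: upp)
      next
        case False
        then have "x' = x" "y < y'" using that Pair q' by auto
        moreover have "int (Suc y) * t \<le> int y' * t" using calculation t0 by (intro mult_right_mono) auto
        ultimately show ?thesis using that Pair q' by (intro bexI[of _ "(x, Suc y)"]) (auto simp: upp)
      qed
    qed
    fix q assume q: "q \<in> ?Q" "diag_nbrs ?Q q = {}"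
      and pl: "\<And>q'. q' \<in> ?Q \<Longrightarrow> level q' \<le> level q \<Longrightarrow>
         ?f q' \<in> P \<and> lo (?f q') = ?f ` lower_nbrs ?Q q' \<and> w (?f q') = ?wt q'"
    \<comment> \<open>Every other cell has a diagonal neighbour; for the bottom row,
      \<open>tr\<close> keeps row \<open>1\<close> inside the region.\<close>
    have q0: "q = (0, 0)"
    proof (rule ccontr)
      assume "q \<noteq> (0, 0)"
      moreover obtain x y where xy: "q = (x, y)" by (cases q)
      ultimately consider i where "x = Suc i" "y = 0" | j where "y = Suc j" by (cases x; cases y) auto
      then show False
      proof cases
        case 1
        then have "(i, Suc 0) \<in> diag_nbrs ?Q q" using xy tr by (simp add: diag_nbrs_def)
        then show False using q by simp
      next
        case 2
        then have "(Suc x, j) \<in> diag_nbrs ?Q q" using xy q(1) mono[of j] by (simp add: diag_nbrs_def)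
        then show False using q by simp
      qed
    qed
    then have "?f (0, 0) = z" using pl[of q] bottom_unique[of "?f (0,0)" z] z q(1) by (simp add: low)
    moreover have "upper_nbrs ?Q (0, 0) = {(Suc 0, 0), (0, Suc 0)}" using tr r_pos by (simp add: upp insert_commute)
    moreover have "lower_nbrs ?Q (Suc 0, 0) = {(0, 0)}" "lower_nbrs ?Q (0, Suc 0) = {(0, 0)}"
      using r_pos by (simp_all add: low)
    ultimately show "up (?f q) = ?f ` upper_nbrs ?Q q \<and> inj_on ?f (upper_nbrs ?Q q) \<and>
        (\<forall>v\<in>upper_nbrs ?Q q. ?f v \<in> P \<and> lo (?f v) = ?f ` lower_nbrs ?Q v \<and> w (?f v) = ?wt v)"
      using q0 f up_z P lo w by (simp add: insert_commute)
  qed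
  show ?thesis using ex_iso by fastforce
qed

text \<open>In the octant only \<open>(0, 0)\<close> and \<open>(1, 0)\<close> lack a diagonal
  neighbour. The map is prescribed at the two cells above \<open>(1, 0)\<close>, where the lower
  covers cannot tell \<open>b\<close> from \<open>b'\<close>.\<close>

lemma one_branch:
  assumes z: "z \<in> P" "lo z = {}" and up_z: "up z = {s}" and up_s: "up s = {b, b'}" "b \<noteq> b'"
    and w: "w s = 2 * r" "w b = 2 * r" "w b' = r"
  shows "\<exists>\<phi>. order_iso \<phi> P (\<le>) (map_prod int int ` {(x, y). y \<le> x}) (\<le>) \<and>
   (\<forall>p\<in>P. \<exists>x y. \<phi> p = (int x, int y) \<and> w p = (if x = y then r else 2 * r))"
proof -
  let ?Q = "{(x, y). y \<le> (x::nat)}" and ?wt = "\<lambda>(x, y). if x = (y::nat) then r else 2 * r"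
  let ?init = "[(Suc (Suc 0), 0) \<mapsto> b, (Suc 0, Suc 0) \<mapsto> b']"
  let ?f = "grid_map ?Q ?init"
  have lo_s: "lo s = {z}" using up_eq_sg[OF z(2)] up_z by (auto simp: sg_def)
  have lo: "lo b = {s}" "lo b' = {s}" using chain_step[OF lo_s up_z] up_s by auto
  have P: "b \<in> P" "b' \<in> P" "s \<in> P" using up_s upD by auto
  have low0: "lower_nbrs ?Q (0, 0) = {}" "lower_nbrs ?Q (Suc x, 0) = {(x, 0)}" for x
    by (auto simp: lower_nbrs_def)
  have low: "y < x \<Longrightarrow> lower_nbrs ?Q (Suc x, Suc y) = {(x, Suc y), (Suc x, y)}"
    "lower_nbrs ?Q (Suc x, Suc x) = {(Suc x, x)}" for x y
    by (auto simp: lower_nbrs_def)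
  have upp: "upper_nbrs ?Q (x, y) = (if y \<le> x then {(Suc x, y)} else {}) \<union> (if y < x then {(x, Suc y)} else {})" if "y \<le> x" for x y
    using that by (auto simp: upper_nbrs_def)
  have SG: "{u \<in> upper_nbrs ?Q (x, y). lower_nbrs ?Q u = {(x, y)}} =
      (if y = 0 then {(Suc x, 0)} else {}) \<union> (if x = Suc y then {(x, x)} else {})"
    if yx: "y \<le> x" for x y
  proof -
    have "lower_nbrs ?Q (Suc x, y) = {(x, y)} \<longleftrightarrow> y = 0"
      using yx by (cases y) (auto simp: low0 low)
    moreover have "lower_nbrs ?Q (x, Suc y) = {(x, y)} \<longleftrightarrow> x = Suc y" if "y < x"
    proof (cases x)
      case (Suc x')
      then show ?thesis using that by (cases "y = x'") (simp_all add: low)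
    qed (use that in simp)
    ultimately show ?thesis using yx unfolding upp[OF yx] by auto
  qed
  have f: "?f (Suc (Suc 0), 0) = b" "?f (Suc 0, Suc 0) = b'"
    by (rule grid_map_Some, simp)+
  interpret grid P w r ?Q ?wt ?init
  proof
    show "(0, 0) \<in> ?Q" "?wt (0, 0) = r" "?init (0, 0) = None" using r_pos by auto
    show "lower_nbrs ?Q q \<noteq> {}" if "q \<in> ?Q" "q \<noteq> (0, 0)" for q
    proof (cases q)
      case (Pair x y)
      show ?thesis
      proof (cases y)
        case 0
        then have "x \<noteq> 0" using that Pair by auto
        then obtain x' where "x = Suc x'" by (cases x) auto
        then show ?thesis using 0 Pair by (simp add: low0)
      next
        case (Suc y')
        then have "(x, y') \<in> lower_nbrs ?Q q" using that Pair by (simp add: lower_nbrs_def)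
        then show ?thesis by blast
      qed
    qed
    show "(x, y) \<in> ?Q \<and> (Suc x, Suc y) \<in> ?Q \<and> ?wt (Suc x, Suc y) = ?wt (x, y)"
      if "(Suc x, y) \<in> ?Q" "(x, Suc y) \<in> ?Q" for x y
      using that by simp
    show "?wt q > 0" if "q \<in> ?Q" for q
      using r_pos by (cases q) simp
    show "2 * ?wt q = sum ?wt (lower_nbrs ?Q q) + sum ?wt {u \<in> upper_nbrs ?Q q. lower_nbrs ?Q u = {q}}"
      if "q \<in> ?Q" for q
    proof (cases q)
      case (Pair x y)
      then have y: "y \<le> x" using that by simp
      show ?thesis unfolding Pair SG[OF y]
      proof (cases y)
        case 0
        then show "2 * ?wt (x, y) = sum ?wt (lower_nbrs ?Q (x, y)) + sum ?wt ((if y = 0 then {(Suc x, 0)} else {}) \<union> (if x = Suc y then {(x, x)} else {}))"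
          by (cases x) (auto simp: low0)
      next
        case (Suc y')
        then obtain x' where x': "x = Suc x'" "y' \<le> x'" using y by (cases x) auto
        then show "2 * ?wt (x, y) = sum ?wt (lower_nbrs ?Q (x, y)) + sum ?wt ((if y = 0 then {(Suc x, 0)} else {}) \<union> (if x = Suc y then {(x, x)} else {}))"
          using Suc by (cases "y' = x'") (auto simp: low)
      qed
    qed
    show "diag_nbrs ?Q u = {}" if "?init q \<noteq> None" "u \<in> lower_nbrs ?Q q" for q u
    proof -
      have "q = (Suc (Suc 0), 0) \<or> q = (Suc 0, Suc 0)" using that(1) by (auto split: if_splits)
      then have "u = (Suc 0, 0)" using that(2) by (auto simp: lower_nbrs_def)
      then show ?thesis by (auto simp: diag_nbrs_def)
    qed
    show "\<exists>v\<in>upper_nbrs ?Q q. v \<le> q'" if "q \<in> ?Q" "q' \<in> ?Q" "q \<le> q'" "q \<noteq> q'" for q q'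
    proof (cases q)
      case (Pair x y)
      obtain x' y' where q': "q' = (x', y')" by (cases q')
      show ?thesis
      proof (cases "x < x'")
        case True
        then show ?thesis using that Pair q' by (intro bexI[of _ "(Suc x, y)"]) (auto simp: upper_nbrs_def)
      next
        case False
        then have "x' = x" "y < y'" using that Pair q' by auto
        then show ?thesis using that Pair q' by (intro bexI[of _ "(x, Suc y)"]) (auto simp: upper_nbrs_def)
      qed
    qed
    fix q assume q: "q \<in> ?Q" "diag_nbrs ?Q q = {}"
      and pl: "\<And>q'. q' \<in> ?Q \<Longrightarrow> level q' \<le> level q \<Longrightarrow>
         ?f q' \<in> P \<and> lo (?f q') = ?f ` lower_nbrs ?Q q' \<and> w (?f q') = ?wt q'"
    have q0: "q = (0, 0) \<or> q = (Suc 0, 0)"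
    proof (rule ccontr)
      assume *: "\<not> (q = (0, 0) \<or> q = (Suc 0, 0))"
      obtain x y where xy: "q = (x, y)" by (cases q)
      have "y \<le> x" using xy q by simp
      then consider i where "x = Suc (Suc i)" "y = 0" | j where "y = Suc j"
        using * xy by (cases y; cases x; cases "x - 1") auto
      then show False
      proof cases
        case 1
        then have "(Suc i, Suc 0) \<in> diag_nbrs ?Q q" using xy by (simp add: diag_nbrs_def)
        then show False using q by simp
      next
        case 2
        then have "(Suc x, j) \<in> diag_nbrs ?Q q" using xy q(1) by (simp add: diag_nbrs_def)
        then show False using q by simp
      qed
    qed
    have f0: "?f (0, 0) = z" using pl[of "(0,0)"] bottom_unique[of "?f (0,0)" z] z by (simp add: low0)
    have l1: "lower_nbrs ?Q (Suc 0, 0) = {(0, 0)}" "lower_nbrs ?Q (Suc (Suc 0), 0) = {(Suc 0, 0)}"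
      "lower_nbrs ?Q (Suc 0, Suc 0) = {(Suc 0, 0)}" by (auto simp: lower_nbrs_def)
    have u1: "upper_nbrs ?Q (0, 0) = {(Suc 0, 0)}"
      "upper_nbrs ?Q (Suc 0, 0) = {(Suc (Suc 0), 0), (Suc 0, Suc 0)}" by (auto simp: upper_nbrs_def)
    have f1: "?f (Suc 0, 0) = s"
    proof (rule grid_map_eqI)
      show "lo s = ?f ` lower_nbrs ?Q (Suc 0, 0)" using l1 f0 lo_s by simp
      show "y = s" if "lo y = ?f ` lower_nbrs ?Q (Suc 0, 0)" for y
        using that l1 f0 up_z lo_up[of z y] by simp
    qed (use P in simp_all)
    show "up (?f q) = ?f ` upper_nbrs ?Q q \<and> inj_on ?f (upper_nbrs ?Q q) \<and>
        (\<forall>v\<in>upper_nbrs ?Q q. ?f v \<in> P \<and> lo (?f v) = ?f ` lower_nbrs ?Q v \<and> w (?f v) = ?wt v)"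
      using q0 f f0 f1 l1 u1 up_z up_s P lo lo_s w by (elim disjE) simp_all
  qed
  show ?thesis using ex_iso by fastforce
qed

text \<open>No cell of a single row has a diagonal neighbour, so \<open>base\<close> carries the
  whole argument: balance gives weight \<open>(int x + 2) * r\<close> to the only cover.\<close>

lemma chain:
  assumes z: "z \<in> P" "lo z = {}" and up1: "\<And>p q q'. q \<in> up p \<Longrightarrow> q' \<in> up p \<Longrightarrow> q = q'"
  shows "\<exists>\<phi>. order_iso \<phi> P (\<le>) (map_prod int int ` {(x, y). y = 0}) (\<le>) \<and>
   (\<forall>p\<in>P. \<exists>x y. \<phi> p = (int x, int y) \<and> y = 0 \<and> w p = (int x + 1) * r)"
proof -
  let ?Q = "{(x :: nat, y). y = (0::nat)}" and ?wt = "\<lambda>(x, y :: nat). (int x + 1) * r"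
  let ?init = "Map.empty :: nat \<times> nat \<Rightarrow> 'a option"
  let ?f = "grid_map ?Q ?init"
  have low: "lower_nbrs ?Q (0, 0) = {}" "lower_nbrs ?Q (Suc x, 0) = {(x, 0)}" for x
    by (auto simp: lower_nbrs_def)
  have upp: "upper_nbrs ?Q (x, 0) = {(Suc x, 0)}" for x
    by (auto simp: upper_nbrs_def)
  interpret grid P w r ?Q ?wt ?init
  proof
    show "(0, 0) \<in> ?Q" "?wt (0, 0) = r" "?init (0, 0) = None" by auto
    show "lower_nbrs ?Q q \<noteq> {}" if "q \<in> ?Q" "q \<noteq> (0, 0)" for q
    proof (cases q)
      case (Pair x y)
      then show ?thesis using that by (cases x) (auto simp: low)
    qed
    show "(x, y) \<in> ?Q \<and> (Suc x, Suc y) \<in> ?Q \<and> ?wt (Suc x, Suc y) = ?wt (x, y)"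
      if "(Suc x, y) \<in> ?Q" "(x, Suc y) \<in> ?Q" for x y
      using that by simp
    show "?wt q > 0" if "q \<in> ?Q" for q
      using r_pos by (cases q) simp
    show "2 * ?wt q = sum ?wt (lower_nbrs ?Q q) + sum ?wt {u \<in> upper_nbrs ?Q q. lower_nbrs ?Q u = {q}}"
      if q: "q \<in> ?Q" for q
    proof -
      obtain x where x: "q = (x, 0)" using q by auto
      have "{u \<in> upper_nbrs ?Q q. lower_nbrs ?Q u = {q}} = {(Suc x, 0)}" by (auto simp: x upp low)
      then show ?thesis by (cases x) (auto simp: x low algebra_simps)
    qed
    show "diag_nbrs ?Q u = {}" if "?init q \<noteq> None" "u \<in> lower_nbrs ?Q q" for q u
      using that by simp
    show "\<exists>v\<in>upper_nbrs ?Q q. v \<le> q'" if "q \<in> ?Q" "q' \<in> ?Q" "q \<le> q'" "q \<noteq> q'" for q q'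
    proof (cases q)
      case (Pair x y)
      then show ?thesis using that by (intro bexI[of _ "(Suc x, y)"]) (auto simp: upp)
    qed
    fix q assume q: "q \<in> ?Q" "diag_nbrs ?Q q = {}"
      and pl: "\<And>q'. q' \<in> ?Q \<Longrightarrow> level q' \<le> level q \<Longrightarrow>
         ?f q' \<in> P \<and> lo (?f q') = ?f ` lower_nbrs ?Q q' \<and> w (?f q') = ?wt q'"
    obtain x where x: "q = (x, 0)" using q by auto
    have p: "?f q \<in> P" "lo (?f q) = ?f ` lower_nbrs ?Q q" "w (?f q) = (int x + 1) * r"
      using pl[OF q(1)] x by auto
    have "sum w (lo (?f q)) = int x * r"
      using p(2) pl[of "(x - 1, 0)"] x by (cases x) (auto simp: low)
    then have s: "sum w (sg (?f q)) = (int x + 2) * r" using balance[OF p(1)] p(3) by (simp add: algebra_simps)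
    moreover have "(int x + 2) * r > 0" using r_pos by simp
    ultimately have "sg (?f q) \<noteq> {}" by force
    then obtain t where t: "t \<in> sg (?f q)" by auto
    have up: "up (?f q) = {t}" using t sg_up up1 by blast
    have sg: "sg (?f q) = {t}" using t up sg_up by blast
    have "t \<in> P" using t sg_up upD by blast
    then have tt: "lo t = {?f q}" "t \<in> P" "w t = (int x + 2) * r" using t s sg by (simp_all add: sg_def)
    have ft: "?f (Suc x, 0) = t"
      by (rule grid_map_eqI) (use tt sg x in \<open>auto simp: low sg_def\<close>)
    show "up (?f q) = ?f ` upper_nbrs ?Q q \<and> inj_on ?f (upper_nbrs ?Q q) \<and>
        (\<forall>v\<in>upper_nbrs ?Q q. ?f v \<in> P \<and> lo (?f v) = ?f ` lower_nbrs ?Q v \<and> w (?f v) = ?wt v)"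
      using x ft up tt by (simp add: upp low)
  qed
  show ?thesis using ex_iso by fastforce
qed

text \<open>Two lower covers of a point would cover a common point of rank below \<open>N\<close>,
  which would then have two upper covers. So the ranks up to \<open>N\<close> form a chain, and
  balance yields the weights \<open>r, 2 * r, 3 * r, ...\<close>.\<close>

lemma unbranched:
  assumes N: "\<And>p q q'. q \<in> up p \<Longrightarrow> q' \<in> up p \<Longrightarrow> rk p < N \<Longrightarrow> q = q'"
    and x: "x \<in> P" "rk x \<le> N"
  shows "w x = (int (rk x) + 1) * r \<and> (rk x > 0 \<longrightarrow> (\<exists>c. lo x = {c} \<and> up c = {x} \<and> w c = int (rk x) * r))"
  using x
proof (induction "rk x" arbitrary: x)
  case 0
  then have "lo x = {}" using rk_lo by fastforce
  then have "w x = r" using bottom bottom_unique 0 by metis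
  then show ?case using 0 by simp
next
  case (Suc n)
  then have "lo x \<noteq> {}" by (auto simp: rk.simps[of x] split: if_splits)
  then obtain c where c: "c \<in> lo x" by auto
  have rc: "rk c = n" using rk_lo[OF c] Suc by simp
  have cP: "c \<in> P" using loD c by blast
  have lo: "lo x = {c}"
  proof (rule ccontr)
    assume "lo x \<noteq> {c}"
    then obtain c' where c': "c' \<in> lo x" "c' \<noteq> c" using c by auto
    then obtain d where d: "d \<in> lo c" "d \<in> lo c'" using common_cover(1)[of c c'] c lo_up by metis
    then have "rk d < N" using rk_lo[OF d(1)] rc Suc by simp
    then show False using N[of c d c'] d lo_up c' by blast
  qed
  have "rk c < N" using rc Suc by simp
  then have up: "up c = {x}" using N[of _ c] c lo_up by blast
  have sg: "sg c = {x}" using up sg_up[of c] lo by (auto simp: sg_def)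
  have IH: "w c = (int n + 1) * r" "n > 0 \<longrightarrow> (\<exists>d. lo c = {d} \<and> w d = int n * r)"
    using Suc.hyps(1)[of c] rc cP Suc by auto
  have "sum w (lo c) = int n * r"
  proof (cases "n = 0")
    case True
    then have "lo c = {}" using rc rk_lo by fastforce
    then show ?thesis using True by simp
  qed (use IH in auto)
  then have "w x = (int n + 2) * r" using balance[OF cP] sg IH by (simp add: algebra_simps)
  then show ?case using lo up IH(1) Suc.hyps(2)[symmetric] by (simp add: algebra_simps)
qed

text \<open>The strip weights are stated multiplied by \<open>k\<close>, so that integers
  suffice.\<close>

theorem classification:
  "(\<exists>\<phi>. order_iso \<phi> P (\<le>) quadrant (\<le>) \<and> (\<forall>p\<in>P. w p = r)) \<or>
   (\<exists>\<phi>. order_iso \<phi> P (\<le>) octant (\<le>) \<and> (\<forall>p\<in>P. w p = (if fst (\<phi> p) = snd (\<phi> p) then r else 2 * r))) \<or>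
   (\<exists>k\<ge>1. \<exists>\<phi>. order_iso \<phi> P (\<le>) (strip k) (\<le>) \<and>
      (\<forall>p\<in>P. int k * w p = r * (int k + fst (\<phi> p) - snd (\<phi> p))))"
proof -
  obtain z where z: "z \<in> P" "lo z = {}" "w z = r" using bottom by metis
  have up_z: "up z = sg z" by (rule up_eq_sg[OF z(2)])
  have sum: "sum w (up z) = 2 * r" using balance[OF z(1)] z up_z by simp
  then have "up z \<noteq> {}" using r_pos by force
  then obtain a where a: "a \<in> up z" by auto
  show ?thesis
  proof (cases "up z = {a}")
    case False
    then obtain b where b: "up z = {a, b}" "a \<noteq> b" using a up_pair by (metis insert_absorb is_singletonI' is_singleton_def singletonD)
    \<comment> \<open>The two atoms may be swapped, so the heavier one goes on the axis along which
      the weights do not decrease.\<close>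
    have two: ?thesis if ab: "up z = {a, b}" "a \<noteq> b" "w a \<ge> w b" for a b
    proof -
      define t where "t = w a - r"
      \<comment> \<open>The two atoms weigh \<open>2 * r\<close> together.\<close>
      have w: "w a = r + t" "w b = r - t" "t \<ge> 0" using sum ab by (auto simp: t_def)
      show ?thesis
      proof (cases "t = 0")
        case True
        have im: "map_prod int int ` {(x, y). int y * t < r} = quadrant"
          using True r_pos by (auto simp: quadrant_def mem_image_int)
        from two_atoms[OF z(1,2) ab(1,2) w(1,2), of 0] True im show ?thesis by auto
      next
        case False
        then have t: "t > 0" using w by simp
        obtain k where k: "k \<ge> 1" "r = int k * t" using corner_region[OF z(2) ab(1,2) w(1,2) t] .
        have "int y * t < r \<longleftrightarrow> y < k" for y unfolding k(2) using t by simp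
        then have region: "{(x :: nat, y). int y * t < r} = {(x, y). y < k}" by simp
        have im: "map_prod int int ` {(x, y). int y * t < r} = strip k"
          unfolding region strip_def by (auto simp: mem_image_int)
        obtain \<phi> where phi: "order_iso \<phi> P (\<le>) (strip k) (\<le>)"
          "\<And>p. p \<in> P \<Longrightarrow> \<exists>x y. \<phi> p = (int x, int y) \<and> w p = r + (int x - int y) * t"
          using two_atoms[OF z(1,2) ab(1,2) w(1,2), of k] t k im by auto
        have "int k * w p = r * (int k + fst (\<phi> p) - snd (\<phi> p))" if "p \<in> P" for p
        proof -
          obtain x y where xy: "\<phi> p = (int x, int y)" "w p = r + (int x - int y) * t"
            using phi(2)[OF \<open>p \<in> P\<close>] by blast
          have "int k * w p = int k * r + (int x - int y) * (int k * t)"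
            unfolding xy(2) by (simp add: algebra_simps)
          then show ?thesis unfolding k(2)[symmetric] xy(1) by (simp add: algebra_simps)
        qed
        then show ?thesis using phi(1) k by blast
      qed
    qed
    show ?thesis
    proof (cases "w a \<ge> w b")
      case True
      then show ?thesis by (rule two[OF b])
    next
      case False
      moreover have "up z = {b, a}" using b by auto
      ultimately show ?thesis using b(2) by (intro two[of b a]) auto
    qed
  next
    case up_a: True
    have wa: "w a = 2 * r" using sum up_a by simp
    have lo_a: "lo a = {z}" using up_a up_z by (auto simp: sg_def)
    show ?thesis
    proof (cases "\<exists>p q q'. q \<in> up p \<and> q' \<in> up p \<and> q \<noteq> q'")
      case False
      have im: "map_prod int int ` {(x, y). y = 0} = strip 1"
        by (auto simp: strip_def mem_image_int)
      have "\<exists>\<phi>. order_iso \<phi> P (\<le>) (strip 1) (\<le>) \<and>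
          (\<forall>p\<in>P. \<exists>x y. \<phi> p = (int x, int y) \<and> y = 0 \<and> w p = (int x + 1) * r)"
        using chain[OF z(1,2)] False unfolding im by blast
      then obtain \<phi> where phi: "order_iso \<phi> P (\<le>) (strip 1) (\<le>)"
        "\<And>p. p \<in> P \<Longrightarrow> \<exists>x y. \<phi> p = (int x, int y) \<and> y = 0 \<and> w p = (int x + 1) * r" by blast
      have "int 1 * w p = r * (int 1 + fst (\<phi> p) - snd (\<phi> p))" if "p \<in> P" for p
        using phi(2)[OF that] by (auto simp: algebra_simps)
      then show ?thesis using phi(1) by blast
    next
      case True
      define B where "B p \<longleftrightarrow> (\<exists>q q'. q \<in> up p \<and> q' \<in> up p \<and> q \<noteq> q')" for p
      \<comment> \<open>A branching point of least rank, so that the ranks up to it form a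
        chain.\<close>
      obtain s where s: "B s" "\<And>p. rk p < rk s \<Longrightarrow> \<not> B p"
        using True ex_has_least_nat[of B _ rk] unfolding B_def by (metis not_le)
      obtain b b' where bb: "up s = {b, b'}" "b \<noteq> b'" using s(1) up_pair unfolding B_def by metis
      have sP: "s \<in> P" using sibling_join[OF bb] by simp
      have N: "\<And>p q q'. q \<in> up p \<Longrightarrow> q' \<in> up p \<Longrightarrow> rk p < rk s \<Longrightarrow> q = q'"
        using s(2) unfolding B_def by blast
      have u: "w s = (int (rk s) + 1) * r"
        "rk s > 0 \<longrightarrow> (\<exists>c. lo s = {c} \<and> up c = {s} \<and> w c = int (rk s) * r)"
        using unbranched[OF N sP] by auto
      have pos: "rk s > 0"
      proof (rule ccontr)
        assume "\<not> rk s > 0"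
        then have "lo s = {}" using rk_lo by fastforce
        then have "s = z" using bottom_unique sP z by blast
        then show False using bb up_a by auto
      qed
      then obtain c where c: "lo s = {c}" "up c = {s}" "w c = int (rk s) * r" using u by blast
      have br: "rk s = 1 \<and> (w b = 2 * r \<and> w b' = r \<or> w b = r \<and> w b' = 2 * r)"
        using branch[OF c(1,2) u(1) c(3) bb r_pos] pos by simp
      have "rk c = 0" using rk_lo[of c s] c br by simp
      then have "lo c = {}" using rk_lo by fastforce
      then have "c = z" using bottom_unique z c loD by blast
      then have sa: "s = a" using c up_a by simp
      have im: "map_prod int int ` {(x, y). y \<le> x} = octant"
        by (auto simp: octant_def mem_image_int nat_le_eq_zle)
      have "up a = {b, b'}" "up a = {b', b}" using bb sa by auto
      then have "\<exists>\<phi>. order_iso \<phi> P (\<le>) octant (\<le>) \<and>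
        (\<forall>p\<in>P. \<exists>x y. \<phi> p = (int x, int y) \<and> w p = (if x = y then r else 2 * r))"
        using br one_branch[OF z(1,2) up_a _ _ wa, of b b'] one_branch[OF z(1,2) up_a _ _ wa, of b' b] bb(2)
        unfolding im by metis
      then obtain \<phi> where phi: "order_iso \<phi> P (\<le>) octant (\<le>)"
        "\<And>p. p \<in> P \<Longrightarrow> \<exists>x y. \<phi> p = (int x, int y) \<and> w p = (if x = y then r else 2 * r)" by blast
      have "w p = (if fst (\<phi> p) = snd (\<phi> p) then r else 2 * r)" if "p \<in> P" for p
        using phi(2)[OF that] by auto
      then show ?thesis using phi(1) by blast
    qed
  qed
qed

end

section \<open>From the lattice to its points\<close>

text \<open>In a distributive lattice a join-irreducible element is join-prime: \<open>p\<close> is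
  the join of \<open>inf p x\<close> and \<open>inf p y\<close>.\<close>

lemma point_le_sup_iff:
  fixes p :: "'a::{distrib_lattice, bounded_lattice_bot}"
  assumes "p \<in> points"
  shows "p \<le> sup x y \<longleftrightarrow> p \<le> x \<or> p \<le> y"
proof
  assume "p \<le> sup x y"
  then have "p = sup (inf p x) (inf p y)"
    by (metis inf.absorb1 inf_sup_distrib1)
  then have "p = inf p x \<or> p = inf p y" using assms unfolding points_def by blast
  then show "p \<le> x \<or> p \<le> y" by (metis inf.cobounded2)
qed (auto intro: le_supI1 le_supI2)

lemma points_below_sup:
  "points_below (sup x y :: 'a::{distrib_lattice, bounded_lattice_bot}) = points_below x \<union> points_below y"
  by (auto simp: points_below_def point_le_sup_iff)

lemma points_below_inf: "points_below (inf x y) = points_below x \<inter> points_below y"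
  by (auto simp: points_below_def)

lemma points_below_bot: "points_below bot = {}"
  by (auto simp: points_below_def points_def bot_unique)

lemma bot_not_point: "bot \<notin> points"
  by (simp add: points_def)

section \<open>Finite ideals of points as lattice elements\<close>

locale lf_distrib_lattice =
  fixes ty :: "'a::{distrib_lattice, bounded_lattice_bot} itself"
  assumes finite_interval: "finite {x..y :: 'a}"
begin

lemma finite_points_below: "finite (points_below (x :: 'a))"
  by (rule finite_subset[OF _ finite_interval[of bot x]]) (auto simp: points_below_def)

text \<open>Every element is the join of the points below it: one that is neither a point nor
  \<open>bot\<close> is a join of two strictly smaller elements, and finite intervals allow
  induction.\<close>

lemma points_below_mono_iff: "points_below x \<subseteq> points_below y \<longleftrightarrow> x \<le> (y :: 'a)"
proof
  show "points_below x \<subseteq> points_below y \<Longrightarrow> x \<le> y"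
  proof (induction "card {bot..x}" arbitrary: x rule: less_induct)
    case less
    have smaller: "a \<le> y" if "a < x" "a \<le> x" for a
    proof (rule less.hyps)
      have "{bot..a} \<subset> {bot..x}" using that by (auto intro: order.trans)
      then show "card {bot..a} < card {bot..x}" by (rule psubset_card_mono[OF finite_interval])
      show "points_below a \<subseteq> points_below y"
        using less.prems that by (auto simp: points_below_def)
    qed
    show ?case
    proof (cases "x \<in> points \<or> x = bot")
      case True
      then show ?thesis using less.prems by (auto simp: points_below_def)
    next
      case False
      then obtain a b where ab: "x = sup a b" "x \<noteq> a" "x \<noteq> b" unfolding points_def by blast
      then have "a < x" "b < x" by (auto simp: order.strict_iff_order)
      then show ?thesis using smaller ab by (simp add: less_imp_le)
    qed
  qed
qed (auto simp: points_below_def intro: order.trans)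

lemma points_below_eq_iff: "points_below x = points_below y \<longleftrightarrow> x = (y :: 'a)"
  using points_below_mono_iff[of x y] points_below_mono_iff[of y x] by auto

lemma points_below_psubset_iff: "points_below x \<subset> points_below y \<longleftrightarrow> x < (y :: 'a)"
  unfolding psubset_eq less_le points_below_mono_iff points_below_eq_iff ..

lemma fin_ideal_points_below: "fin_ideal points (points_below (x :: 'a))"
  using finite_points_below by (auto simp: fin_ideal_def points_below_def)

text \<open>The witness is the join of the elements of the ideal. Points are join-prime, so a point
  lies below this join only if it lies below one of them.\<close>

lemma ex_points_below:
  assumes "fin_ideal points I"
  shows "\<exists>x :: 'a. points_below x = I"
proof -
  have "\<exists>x :: 'a. points_below x = {p \<in> points. \<exists>d\<in>D. p \<le> d}" if "finite D" for D
    using that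
  proof induction
    case empty
    then show ?case using points_below_bot by (intro exI[of _ bot]) simp
  next
    case (insert d D)
    then obtain x :: 'a where x: "points_below x = {p \<in> points. \<exists>d\<in>D. p \<le> d}" by blast
    have "points_below (sup d x) = {p \<in> points. \<exists>d\<in>insert d D. p \<le> d}"
      unfolding points_below_sup x by (auto simp: points_below_def)
    then show ?case by blast
  qed
  moreover have "I = {p \<in> points. \<exists>d\<in>I. p \<le> d}" "finite I"
    using assms by (auto simp: fin_ideal_def)
  ultimately show ?thesis by metis
qed

definition elt :: "'a set \<Rightarrow> 'a" where "elt I = (THE x. points_below x = I)"

lemma elt_points_below: "elt (points_below x) = x"
  unfolding elt_def by (rule the_equality) (auto simp: points_below_eq_iff)

lemma points_below_elt: "fin_ideal points I \<Longrightarrow> points_below (elt I) = I"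
  using ex_points_below elt_points_below by metis

text \<open>A minimal point \<open>p\<close> of the difference can be added to
  \<open>points_below x\<close>, and the resulting element lies strictly above \<open>x\<close> and
  not above more than \<open>y\<close> allows, so it is \<open>y\<close>.\<close>

lemma covered_by_iff:
  "x \<lessdot> (y :: 'a) \<longleftrightarrow> (\<exists>p. p \<notin> points_below x \<and> points_below y = insert p (points_below x))"
proof
  assume xy: "x \<lessdot> y"
  then have "x < y" by (simp add: covers_in_def)
  then have ss: "points_below x \<subset> points_below y" by (simp add: points_below_psubset_iff)
  let ?S = "points_below y - points_below x"
  have "finite ?S" "?S \<noteq> {}" using finite_points_below ss by auto
  then obtain p where p: "p \<in> ?S" "\<And>q. q \<in> ?S \<Longrightarrow> q \<le> p \<Longrightarrow> p = q"
    using finite_has_minimal[of ?S] by blast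
  have "q \<in> insert p (points_below x)" if "q \<in> points" "q \<le> p" for q
  proof (rule ccontr)
    assume n: "q \<notin> insert p (points_below x)"
    then have "q \<in> ?S" using that p(1) by (auto simp: points_below_def intro: order.trans)
    then show False using p(2)[of q] that n by auto
  qed
  then have "fin_ideal points (insert p (points_below x))"
    using fin_ideal_points_below[of x] p(1) unfolding fin_ideal_def
    by (auto simp: points_below_def)
  then obtain z where z: "points_below z = insert p (points_below x)" using ex_points_below by blast
  have "x < z" unfolding points_below_psubset_iff[symmetric] z using p(1) by auto
  moreover have "z \<le> y" unfolding points_below_mono_iff[symmetric] z using p(1) ss by auto
  ultimately have "z = y" using xy by (auto simp: covers_in_def order_le_less)
  then show "\<exists>p. p \<notin> points_below x \<and> points_below y = insert p (points_below x)"
    using z p(1) by blast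
next
  assume "\<exists>p. p \<notin> points_below x \<and> points_below y = insert p (points_below x)"
  then obtain p where p: "p \<notin> points_below x" "points_below y = insert p (points_below x)" by blast
  have "x < y" unfolding points_below_psubset_iff[symmetric] using p by auto
  moreover have "\<not> (x < z \<and> z < y)" for z
    unfolding points_below_psubset_iff[symmetric] p(2) by blast
  ultimately show "x \<lessdot> y" by (simp add: covers_in_def)
qed

lemma coveredI: "p \<notin> points_below x \<Longrightarrow> points_below y = insert p (points_below x) \<Longrightarrow> x \<lessdot> (y :: 'a)"
  using covered_by_iff by blast

lemma fin_ideal_remove_max:
  assumes I: "fin_ideal points I" and q: "q \<in> max_elts I"
  shows "fin_ideal points (I - {q})"
  using assms by (auto simp: fin_ideal_def max_elts_def order_le_less)

lemma fin_ideal_insert_min: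
  assumes I: "fin_ideal points I" and q: "q \<in> min_elts_outside points I"
  shows "fin_ideal points (insert q I)"
  using assms by (auto simp: fin_ideal_def min_elts_outside_def order_le_less)

lemma point_max: "p \<in> points \<Longrightarrow> p \<in> max_elts (points_below p)"
  by (auto simp: max_elts_def points_below_def)

text \<open>The unique lower cover of the join-irreducible element \<open>p\<close>.\<close>

definition lower :: "'a \<Rightarrow> 'a" where "lower p = elt (points_below p - {p})"

lemma points_below_lower: "p \<in> points \<Longrightarrow> points_below (lower p) = points_below p - {p}"
  unfolding lower_def
  by (intro points_below_elt fin_ideal_remove_max fin_ideal_points_below point_max)

lemma lower_covered:
  assumes "p \<in> points"
  shows "lower p \<lessdot> p"
proof -
  have "p \<in> points_below p" using assms by (simp add: points_below_def)
  then show ?thesis by (intro coveredI[of p]) (auto simp: points_below_lower[OF assms])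
qed

end

section \<open>Weights carried by points\<close>

locale distrib_fomin_lattice = fomin_lattice r w + lf_distrib_lattice "TYPE('a)"
  for r :: "'v::ab_group_add" and w :: "'a::{distrib_lattice, bounded_lattice_bot} \<Rightarrow> 'a \<Rightarrow> 'v"
begin

definition wP :: "'a \<Rightarrow> 'v" where "wP p = w (lower p) p"

text \<open>Projective constancy slides a covering downwards: removing from \<open>y\<close> a
  maximal point \<open>q\<close> not below \<open>p\<close> gives \<open>y'\<close>, and
  \<open>x\<close> and \<open>y'\<close> span a square with top \<open>y\<close>. The slide ends at
  \<open>y = p\<close>, where \<open>x\<close> is \<open>lower p\<close>.\<close>

lemma weight_by_point:
  assumes "p \<notin> points_below x" "points_below y = insert p (points_below x)"
  shows "w x y = wP p"
  using assms
proof (induction "card (points_below y - points_below p)" arbitrary: x y rule: less_induct)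
  case less
  have py: "p \<in> points_below y" using less.prems by simp
  have pp: "p \<in> points" "p \<le> y" using py by (auto simp: points_below_def)
  show ?case
  proof (cases "y = p")
    case True
    then have "points_below x = points_below (lower p)"
      using less.prems pp points_below_lower[of p] by auto
    then show ?thesis using True by (simp add: points_below_eq_iff wP_def)
  next
    case False
    let ?S = "points_below y - points_below p"
    have "\<not> y \<le> p" using False pp by auto
    then have "?S \<noteq> {}" unfolding points_below_mono_iff[symmetric] by auto
    moreover have fS: "finite ?S" using finite_points_below by blast
    ultimately obtain q where q: "q \<in> ?S" "\<And>s. s \<in> ?S \<Longrightarrow> q \<le> s \<Longrightarrow> q = s"
      using finite_has_maximal[of ?S] by blast
    \<comment> \<open>A point above \<open>q\<close> is not below \<open>p\<close> either, so
      maximality in \<open>?S\<close> is maximality among all points below \<open>y\<close>.\<close>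
    have "q \<in> max_elts (points_below y)"
      unfolding max_elts_def
    proof (intro CollectI conjI ballI notI)
      fix s assume s: "s \<in> points_below y" "q < s"
      then have "s \<in> ?S" using q(1) by (auto simp: points_below_def)
      then show False using q(2)[of s] s(2) by (simp add: less_imp_le)
    qed (use q in auto)
    then have id: "fin_ideal points (points_below y - {q})"
      by (rule fin_ideal_remove_max[OF fin_ideal_points_below])
    define y' where "y' = elt (points_below y - {q})"
    have y': "points_below y' = points_below y - {q}" unfolding y'_def by (rule points_below_elt[OF id])
    have qp: "q \<noteq> p" using q(1) pp by (auto simp: points_below_def)
    have qx: "q \<in> points_below x" using q(1) less.prems qp by auto
    have inf: "points_below (inf x y') = points_below y - {p, q}"
      unfolding points_below_inf y' using less.prems by auto
    have "points_below (sup x y') = points_below y"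
      unfolding points_below_sup y' using less.prems qp qx by auto
    then have sup: "sup x y' = y" by (simp add: points_below_eq_iff)
    have c: "x \<lessdot> y" "y' \<lessdot> y" "inf x y' \<lessdot> x" "inf x y' \<lessdot> y'"
      using less.prems q(1) qp py
      by (intro coveredI[of p x y] coveredI[of q y' y] coveredI[of q "inf x y'" x] coveredI[of p "inf x y'" y'];
        auto simp: inf y')+
    have "w (inf x y') y' = w x y"
      using projective_constant[of x y'] c unfolding sup by blast
    moreover have "w (inf x y') y' = wP p"
    proof (rule less.hyps)
      have "points_below y' - points_below p \<subset> ?S" using q(1) unfolding y' by auto
      then show "card (points_below y' - points_below p) < card ?S" by (rule psubset_card_mono[OF fS])
      show "p \<notin> points_below (inf x y')" "points_below y' = insert p (points_below (inf x y'))"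
        unfolding inf y' using py qp by auto
    qed
    ultimately show ?thesis by simp
  qed
qed

lemma given_by_points: "given_by_points w wP"
  unfolding given_by_points_def
proof (intro allI impI)
  fix x y :: 'a assume "x \<lessdot> y"
  then obtain p where "p \<notin> points_below x" "points_below y = insert p (points_below x)"
    using covered_by_iff by blast
  then show "\<exists>p. points_below y - points_below x = {p} \<and> w x y = wP p"
    using weight_by_point[of p x y] by (intro exI[of _ p]) auto
qed

lemma min_cover:
  assumes "q \<in> min_elts_outside points (points_below x)"
  shows "points_below (elt (insert q (points_below x))) = insert q (points_below x)"
    and "x \<lessdot> elt (insert q (points_below x))"
proof -
  show *: "points_below (elt (insert q (points_below x))) = insert q (points_below x)"
    by (intro points_below_elt fin_ideal_insert_min fin_ideal_points_below assms)
  show "x \<lessdot> elt (insert q (points_below x))"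
    by (rule coveredI[OF _ *]) (use assms in \<open>simp add: min_elts_outside_def\<close>)
qed

lemma max_cover:
  assumes "q \<in> max_elts (points_below x)"
  shows "points_below (elt (points_below x - {q})) = points_below x - {q}"
    and "elt (points_below x - {q}) \<lessdot> x"
proof -
  show *: "points_below (elt (points_below x - {q})) = points_below x - {q}"
    by (intro points_below_elt fin_ideal_remove_max fin_ideal_points_below assms)
  show "elt (points_below x - {q}) \<lessdot> x"
    by (rule coveredI[of q]) (use assms in \<open>auto simp: * max_elts_def\<close>)
qed

lemma upper_cover_min:
  assumes "p \<notin> points_below x" "points_below z = insert p (points_below x)"
  shows "p \<in> min_elts_outside points (points_below x)"
proof -
  have "p \<in> points_below z" using assms by simp
  then have p: "p \<in> points" "p \<le> z" by (auto simp: points_below_def)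
  have "q \<in> points_below x" if "q \<in> points" "q < p" for q
  proof -
    have "q \<in> points_below z" using that p by (auto simp: points_below_def)
    then show ?thesis using assms that by auto
  qed
  then show ?thesis using assms p by (auto simp: min_elts_outside_def)
qed

lemma lower_cover_max:
  assumes "p \<notin> points_below y" "points_below x = insert p (points_below y)"
  shows "p \<in> max_elts (points_below x)"
proof -
  have "p \<in> points_below x" using assms by simp
  then have p: "p \<in> points" "p \<le> x" by (auto simp: points_below_def)
  have "\<not> p < q" if "q \<in> points_below x" for q
  proof
    assume pq: "p < q"
    then have "q \<in> points_below y" using that assms by auto
    then have "p \<in> points_below y" using pq p by (auto simp: points_below_def)
    then show False using assms by simp
  qed
  then show ?thesis using assms by (auto simp: max_elts_def)
qed

lemma finite_mins: "finite (min_elts_outside points (points_below (x :: 'a)))"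
proof (rule finite_subset)
  show "finite ((\<lambda>z. the_elem (points_below z - points_below x)) ` {z. x \<lessdot> z})"
    by (rule finite_imageI[OF finite_upper_covers])
  show "min_elts_outside points (points_below x) \<subseteq> (\<lambda>z. the_elem (points_below z - points_below x)) ` {z. x \<lessdot> z}"
  proof
    fix q assume q: "q \<in> min_elts_outside points (points_below x)"
    then have "q \<notin> points_below x" by (simp add: min_elts_outside_def)
    then have "points_below (elt (insert q (points_below x))) - points_below x = {q}"
      unfolding min_cover(1)[OF q] by auto
    then show "q \<in> (\<lambda>z. the_elem (points_below z - points_below x)) ` {z. x \<lessdot> z}"
      using min_cover(2)[OF q] by (intro image_eqI[of _ _ "elt (insert q (points_below x))"]) auto
  qed
qed

text \<open>Upper covers of \<open>x\<close> correspond to the points that can be added to its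
  ideal, and \<open>weight_by_point\<close> matches the summands.\<close>

lemma sum_upper_covers: "(\<Sum>z | x \<lessdot> z. w x z) = sum wP (min_elts_outside points (points_below x))"
proof (rule sum.reindex_bij_witness[where i = "\<lambda>q. elt (insert q (points_below x))"
      and j = "\<lambda>z. the_elem (points_below z - points_below x)"])
  fix z assume "z \<in> {z. x \<lessdot> z}"
  then obtain p where p: "p \<notin> points_below x" "points_below z = insert p (points_below x)"
    using covered_by_iff by blast
  then have e: "the_elem (points_below z - points_below x) = p" by (simp add: insert_Diff_if)
  show "elt (insert (the_elem (points_below z - points_below x)) (points_below x)) = z"
    unfolding e p(2)[symmetric] by (rule elt_points_below)
  show "the_elem (points_below z - points_below x) \<in> min_elts_outside points (points_below x)"
    unfolding e by (rule upper_cover_min[OF p])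
  show "wP (the_elem (points_below z - points_below x)) = w x z"
    unfolding e using weight_by_point[OF p] by simp
next
  fix q assume q: "q \<in> min_elts_outside points (points_below x)"
  then have "q \<notin> points_below x" by (simp add: min_elts_outside_def)
  then show "the_elem (points_below (elt (insert q (points_below x))) - points_below x) = q"
    unfolding min_cover(1)[OF q] by (simp add: insert_Diff_if)
  show "elt (insert q (points_below x)) \<in> {z. x \<lessdot> z}" using min_cover(2)[OF q] by simp
qed

lemma sum_lower_covers: "(\<Sum>y | y \<lessdot> x. w y x) = sum wP (max_elts (points_below x))"
proof (rule sum.reindex_bij_witness[where i = "\<lambda>q. elt (points_below x - {q})"
      and j = "\<lambda>y. the_elem (points_below x - points_below y)"])
  fix y assume "y \<in> {y. y \<lessdot> x}"
  then obtain p where p: "p \<notin> points_below y" "points_below x = insert p (points_below y)"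
    using covered_by_iff by blast
  then have e: "the_elem (points_below x - points_below y) = p" by (simp add: insert_Diff_if)
  have d: "points_below x - {p} = points_below y" using p by simp
  show "elt (points_below x - {the_elem (points_below x - points_below y)}) = y"
    unfolding e d by (rule elt_points_below)
  show "the_elem (points_below x - points_below y) \<in> max_elts (points_below x)"
    unfolding e by (rule lower_cover_max[OF p])
  show "wP (the_elem (points_below x - points_below y)) = w y x"
    unfolding e using weight_by_point[OF p] by simp
next
  fix q assume q: "q \<in> max_elts (points_below x)"
  then have "points_below x - (points_below x - {q}) = {q}" by (auto simp: max_elts_def)
  then show "the_elem (points_below x - points_below (elt (points_below x - {q}))) = q"
    unfolding max_cover(1)[OF q] by simp
  show "elt (points_below x - {q}) \<in> {y. y \<lessdot> x}" using max_cover(2)[OF q] by simp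
qed

end

section \<open>Products from disconnected points\<close>

context lf_distrib_lattice
begin

lemma lattice_on_points_below:
  "lattice_on {x :: 'a. points_below x \<subseteq> A} (\<le>)"
proof -
  have "\<exists>s\<in>{x. points_below x \<subseteq> A}. x \<le> s \<and> y \<le> s \<and> (\<forall>u\<in>{x. points_below x \<subseteq> A}. x \<le> u \<and> y \<le> u \<longrightarrow> s \<le> u)"
    if "points_below x \<subseteq> A" "points_below y \<subseteq> A" for x y :: 'a
    using that by (intro bexI[of _ "sup x y"]) (auto simp: points_below_sup)
  moreover have "\<exists>s\<in>{x. points_below x \<subseteq> A}. s \<le> x \<and> s \<le> y \<and> (\<forall>u\<in>{x. points_below x \<subseteq> A}. u \<le> x \<and> u \<le> y \<longrightarrow> u \<le> s)"
    if "points_below x \<subseteq> A" "points_below y \<subseteq> A" for x y :: 'a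
    using that by (intro bexI[of _ "inf x y"]) (auto simp: points_below_inf)
  ultimately show ?thesis
    unfolding lattice_on_def by (auto simp: reflp_on_def transp_on_def antisymp_on_def)
qed

text \<open>The complement \<open>B\<close> of \<open>A\<close> is closed under comparability as
  well, so an ideal of points is the disjoint union of an ideal in \<open>A\<close> and one in
  \<open>B\<close>. The factors consist of the elements whose points all lie in \<open>A\<close>,
  respectively in \<open>B\<close>.\<close>

lemma decomposable_of_disconnected:
  fixes A :: "'a set"
  assumes A: "A \<subseteq> points" "A \<noteq> {}" "A \<noteq> points"
    and closed: "\<And>p q. p \<in> A \<Longrightarrow> q \<in> points \<Longrightarrow> p \<le> q \<or> q \<le> p \<Longrightarrow> q \<in> A"
  shows "product_decomposable TYPE('a)"
proof -
  define B where "B = points - A"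
  define h where "h x = (elt (points_below x \<inter> A), elt (points_below x \<inter> B))" for x :: 'a
  have closed_B: "q \<in> B" if "p \<in> B" "q \<in> points" "p \<le> q \<or> q \<le> p" for p q
    using that closed[of q p] by (auto simp: B_def)
  have pb: "points_below x = (points_below x \<inter> A) \<union> (points_below x \<inter> B)" for x :: 'a
    by (auto simp: points_below_def B_def)
  have hA: "points_below (elt (points_below x \<inter> A)) = points_below x \<inter> A" for x
  proof (rule points_below_elt)
    have down: "q \<in> points_below x \<inter> A" if "p \<in> points_below x \<inter> A" "q \<in> points" "q \<le> p" for p q
      using that closed[of p q] by (auto simp: points_below_def)
    have "finite (points_below x \<inter> A)" "points_below x \<inter> A \<subseteq> points"
      using finite_points_below by (auto simp: points_below_def)
    then show "fin_ideal points (points_below x \<inter> A)"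
      unfolding fin_ideal_def using down by blast
  qed
  have hB: "points_below (elt (points_below x \<inter> B)) = points_below x \<inter> B" for x
  proof (rule points_below_elt)
    have down: "q \<in> points_below x \<inter> B" if "p \<in> points_below x \<inter> B" "q \<in> points" "q \<le> p" for p q
      using that closed_B[of p q] by (auto simp: points_below_def)
    have "finite (points_below x \<inter> B)" "points_below x \<inter> B \<subseteq> points"
      using finite_points_below by (auto simp: points_below_def)
    then show "fin_ideal points (points_below x \<inter> B)"
      unfolding fin_ideal_def using down by blast
  qed
  let ?CA = "{x :: 'a. points_below x \<subseteq> A}" and ?CB = "{x :: 'a. points_below x \<subseteq> B}"
  have ord: "x \<le> y \<longleftrightarrow> fst (h x) \<le> fst (h y) \<and> snd (h x) \<le> snd (h y)" for x y
    unfolding points_below_mono_iff[symmetric] h_def fst_conv snd_conv hA hB using pb[of x] by blast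
  have "bij_betw h UNIV (?CA \<times> ?CB)"
    unfolding bij_betw_def
  proof
    show "inj h"
    proof (rule injI)
      fix x y assume "h x = h y"
      then have "x \<le> y" "y \<le> x" unfolding ord[of x y] ord[of y x] by auto
      then show "x = y" by (rule order_antisym)
    qed
    show "range h = ?CA \<times> ?CB"
    proof (intro equalityI subsetI)
      fix c assume "c \<in> ?CA \<times> ?CB"
      then obtain a b where ab: "c = (a, b)" "points_below a \<subseteq> A" "points_below b \<subseteq> B" by auto
      have "points_below (sup a b) \<inter> A = points_below a" "points_below (sup a b) \<inter> B = points_below b"
        using ab unfolding points_below_sup by (auto simp: B_def)
      then have "h (sup a b) = c" by (simp add: h_def ab(1) elt_points_below)
      then show "c \<in> range h" by blast
    qed (auto simp: h_def hA hB)
  qed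
  then have "order_iso h UNIV (\<le>) (?CA \<times> ?CB) (\<lambda>(a, b) (a', b'). a \<le> a' \<and> b \<le> b')"
    unfolding order_iso_def case_prod_beta using ord by blast
  moreover have nt: "nontrivial {x :: 'a. points_below x \<subseteq> C}"
    if "p \<in> C" "C \<subseteq> points" "\<And>p q. p \<in> C \<Longrightarrow> q \<in> points \<Longrightarrow> p \<le> q \<or> q \<le> p \<Longrightarrow> q \<in> C" for p C
  proof -
    have "p \<in> {x. points_below x \<subseteq> C}" using that(1) that(3)[of p] unfolding points_below_def by blast
    moreover have "bot \<in> {x :: 'a. points_below x \<subseteq> C}" by (simp add: points_below_bot)
    moreover have "p \<noteq> bot" using that(1,2) bot_not_point by blast
    ultimately show ?thesis unfolding nontrivial_def by blast
  qed
  obtain a b where "a \<in> A" "b \<in> B" using A B_def by blast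
  then have "nontrivial ?CA" "nontrivial ?CB"
    using nt[of a A] nt[of b B] A(1) closed closed_B unfolding B_def by blast+
  ultimately show ?thesis
    unfolding product_decomposable_def using lattice_on_points_below by blast
qed

end

text \<open>Each clause is read off through the correspondence of ideals and elements;
  \<open>connected\<close> is the contrapositive of
  \<open>decomposable_of_disconnected\<close>.\<close>

lemma differential_poset_points:
  fixes w :: "'a::{distrib_lattice, bounded_lattice_bot} \<Rightarrow> 'a \<Rightarrow> int" and r :: int
  assumes "distrib_fomin_lattice r w" and ucm: "unique_cover_modular (points :: 'a set)"
    and w_pos: "\<And>x y. x \<lessdot> y \<Longrightarrow> w x y > 0" and r_pos: "r > 0"
    and indec: "\<not> product_decomposable TYPE('a)"
  shows "differential_poset points (distrib_fomin_lattice.wP w) r"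
proof -
  interpret distrib_fomin_lattice r w by fact
  show ?thesis
  proof
    show "finite {q \<in> points. q \<le> p}" for p :: 'a
      using finite_points_below[of p] by (simp add: points_below_def)
    show "finite (min_elts_outside points I)" if "fin_ideal points I" for I :: "'a set"
      using finite_mins ex_points_below[OF that] by auto
    show "sum wP (max_elts I) + r = sum wP (min_elts_outside points I)" if I: "fin_ideal points I" for I
    proof -
      obtain x where x: "points_below x = I" using ex_points_below[OF I] by blast
      show ?thesis
        using differential[of x] unfolding sum_upper_covers sum_lower_covers x .
    qed
    show "wP p > 0" if "p \<in> points" for p
      unfolding wP_def by (rule w_pos[OF lower_covered[OF that]])
    show "A = points" if "A \<subseteq> points" "A \<noteq> {}"
      "\<And>p q. p \<in> A \<Longrightarrow> q \<in> points \<Longrightarrow> p \<le> q \<or> q \<le> p \<Longrightarrow> q \<in> A" for A :: "'a set"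
      using decomposable_of_disconnected[of A] that indec by blast
  qed (use ucm r_pos in auto)
qed

section \<open>Diagrams and partitions\<close>

text \<open>Left-justified rows of cells: row \<open>i\<close>, present for \<open>i \<in> R\<close>, starts in column \<open>s i\<close>.\<close>

definition cells :: "nat set \<Rightarrow> (nat \<Rightarrow> int) \<Rightarrow> (int \<times> int) set" where
  "cells R s = {(u, v). \<exists>i\<in>R. v = int i \<and> s i \<le> u}"

text \<open>\<open>f i\<close> is the length of row \<open>i\<close>. Row ends decrease weakly,
  which is demanded only before a nonempty row: an empty row of a shifted shape may start beyond the
  end of the row before it.\<close>

definition shapes :: "nat set \<Rightarrow> (nat \<Rightarrow> int) \<Rightarrow> (nat \<Rightarrow> nat) set" where
  "shapes R s = {f. finite {i. f i \<noteq> 0} \<and> (\<forall>i. f i \<noteq> 0 \<longrightarrow> i \<in> R) \<and>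
     (\<forall>i. f (Suc i) \<noteq> 0 \<longrightarrow> s (Suc i) + int (f (Suc i)) \<le> s i + int (f i))}"

definition diagram :: "(nat \<Rightarrow> int) \<Rightarrow> (nat \<Rightarrow> nat) \<Rightarrow> (int \<times> int) set" where
  "diagram s f = {(u, v). \<exists>i. v = int i \<and> s i \<le> u \<and> u < s i + int (f i)}"

lemma mem_diagram: "(u, int i) \<in> diagram s f \<longleftrightarrow> s i \<le> u \<and> u < s i + int (f i)"
  by (auto simp: diagram_def)

lemma mem_cells: "(u, int i) \<in> cells R s \<longleftrightarrow> i \<in> R \<and> s i \<le> u"
  by (auto simp: cells_def)

lemma diagram_subset_iff: "diagram s f \<subseteq> diagram s g \<longleftrightarrow> f \<le> g"
proof
  assume sub: "diagram s f \<subseteq> diagram s g"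
  have "f i \<le> g i" for i
  proof (rule ccontr)
    assume "\<not> f i \<le> g i"
    \<comment> \<open>The last cell of row \<open>i\<close> of \<open>f\<close>.\<close>
    then have "(s i + int (f i) - 1, int i) \<in> diagram s f" "(s i + int (f i) - 1, int i) \<notin> diagram s g"
      by (auto simp: mem_diagram)
    then show False using sub by blast
  qed
  then show "f \<le> g" by (simp add: le_fun_def)
next
  assume "f \<le> g"
  then have "s i + int (f i) \<le> s i + int (g i)" for i by (simp add: le_fun_def)
  then show "diagram s f \<subseteq> diagram s g"
    unfolding diagram_def by (blast intro: less_le_trans)
qed

lemma initial_segment:
  fixes A :: "int set"
  assumes "finite A" "A \<subseteq> {a..}" "\<And>x y. x \<in> A \<Longrightarrow> a \<le> y \<Longrightarrow> y \<le> x \<Longrightarrow> y \<in> A"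
  shows "A = {a..<a + int (card A)}"
proof (cases "A = {}")
  case False
  have "A = {a..Max A}"
    using assms(2) Max_ge[OF assms(1)] assms(3)[OF Max_in[OF assms(1) False]] by auto
  then obtain m where m: "A = {a..m}" by blast
  then have "a \<le> m" using False by auto
  then show ?thesis unfolding m by auto
qed simp

section \<open>Finite ideals of cells and their row lengths\<close>

context
  fixes R :: "nat set" and s :: "nat \<Rightarrow> int"
  assumes R: "\<And>i. Suc i \<in> R \<Longrightarrow> i \<in> R" and s: "\<And>i. s i \<le> s (Suc i)"
begin

lemma shape_step_down:
  assumes "f \<in> shapes R s" "i \<le> j" "f j \<noteq> 0"
  shows "s j + int (f j) \<le> s i + int (f i) \<and> f i \<noteq> 0"
  using assms(2,3)
proof (induction j rule: dec_induct)
  case (step j)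
  have "s (Suc j) + int (f (Suc j)) \<le> s j + int (f j)" using assms(1) step.prems by (simp add: shapes_def)
  then show ?case using s[of j] step by auto
qed simp

text \<open>Row ends decrease weakly as \<open>i\<close> grows, so a cell below a cell of the
  diagram lies before the end of its own row.\<close>

lemma diagram_ideal:
  assumes f: "f \<in> shapes R s"
  shows "fin_ideal (cells R s) (diagram s f)"
  unfolding fin_ideal_def
proof (intro conjI ballI impI)
  have "diagram s f = (\<Union>i\<in>{i. f i \<noteq> 0}. (\<lambda>u. (u, int i)) ` {s i..<s i + int (f i)})"
  proof (intro equalityI subsetI)
    fix c assume "c \<in> diagram s f"
    then obtain u i where c: "c = (u, int i)" "u \<in> {s i..<s i + int (f i)}" by (auto simp: diagram_def)
    then have "i \<in> {i. f i \<noteq> 0}" by auto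
    then show "c \<in> (\<Union>i\<in>{i. f i \<noteq> 0}. (\<lambda>u. (u, int i)) ` {s i..<s i + int (f i)})" using c by blast
  qed (auto simp: diagram_def)
  then show "finite (diagram s f)" using f by (simp add: shapes_def)
  show "diagram s f \<subseteq> cells R s" using f by (auto simp: diagram_def cells_def shapes_def)
  fix p q assume p: "p \<in> diagram s f" and q: "q \<in> cells R s" "q \<le> p"
  obtain u j where uj: "p = (u, int j)" "s j \<le> u" "u < s j + int (f j)" using p by (auto simp: diagram_def)
  obtain v i where vi: "q = (v, int i)" "i \<in> R" "s i \<le> v" using q by (auto simp: cells_def)
  have "v \<le> u" "i \<le> j" using q(2) uj vi by auto
  moreover have "f j \<noteq> 0" using uj by auto
  ultimately show "q \<in> diagram s f"
    using shape_step_down[OF f] uj vi by (fastforce simp: mem_diagram)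
qed

text \<open>In each row an ideal is a finite initial segment, so the lengths \<open>f\<close>
  describe it. The last cell of row \<open>Suc i\<close> forces the cell in the same column of row
  \<open>i\<close>, which gives the condition on row ends.\<close>

lemma ideal_diagram:
  assumes D: "fin_ideal (cells R s) D"
  obtains f where "f \<in> shapes R s" "D = diagram s f"
proof -
  define A where "A i = {u. (u, int i) \<in> D}" for i
  define f where "f i = card (A i)" for i
  have sub: "D \<subseteq> cells R s" and fin: "finite D" and down: "\<And>p q. p \<in> D \<Longrightarrow> q \<in> cells R s \<Longrightarrow> q \<le> p \<Longrightarrow> q \<in> D"
    using D by (auto simp: fin_ideal_def)
  have A: "A i = {s i..<s i + int (f i)}" for i
    unfolding f_def
  proof (rule initial_segment)
    have "A i \<subseteq> fst ` D" unfolding A_def by force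
    then show "finite (A i)" using fin finite_subset by blast
    show "A i \<subseteq> {s i..}" using sub by (auto simp: A_def cells_def)
    show "y \<in> A i" if "x \<in> A i" "s i \<le> y" "y \<le> x" for x y
      using that sub down[of "(x, int i)" "(y, int i)"] by (auto simp: A_def mem_cells)
  qed
  have fR: "i \<in> R" if "f i \<noteq> 0" for i
  proof -
    have "s i \<in> A i" using that A by simp
    then show ?thesis using sub by (auto simp: A_def mem_cells)
  qed
  have "D = diagram s f"
  proof (intro equalityI subsetI)
    fix p assume p: "p \<in> D"
    then obtain u i where ui: "p = (u, int i)" using sub by (auto simp: cells_def)
    then have "u \<in> A i" using p by (simp add: A_def)
    then show "p \<in> diagram s f" unfolding ui A by (simp add: mem_diagram)
  next
    fix p assume "p \<in> diagram s f"
    then obtain u i where ui: "p = (u, int i)" "u \<in> A i" unfolding A by (auto simp: diagram_def)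
    then show "p \<in> D" by (simp add: A_def)
  qed
  moreover have "f \<in> shapes R s"
    unfolding shapes_def
  proof (intro CollectI conjI allI impI)
    have "{i. f i \<noteq> 0} \<subseteq> (\<lambda>p. nat (snd p)) ` D"
    proof
      fix i assume "i \<in> {i. f i \<noteq> 0}"
      then have "s i \<in> A i" using A by simp
      then show "i \<in> (\<lambda>p. nat (snd p)) ` D" unfolding A_def by force
    qed
    then show "finite {i. f i \<noteq> 0}" using fin finite_subset by blast
    show "i \<in> R" if "f i \<noteq> 0" for i by (rule fR[OF that])
    show "s (Suc i) + int (f (Suc i)) \<le> s i + int (f i)" if nz: "f (Suc i) \<noteq> 0" for i
    proof -
      let ?u = "s (Suc i) + int (f (Suc i)) - 1"
      have "?u \<in> A (Suc i)" using nz A by simp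
      moreover have "(?u, int i) \<in> cells R s" using nz s[of i] R fR[OF nz] by (simp add: mem_cells)
      ultimately have "?u \<in> A i"
        using down[of "(?u, int (Suc i))" "(?u, int i)"] by (simp add: A_def)
      then show ?thesis using A by simp
    qed
  qed
  ultimately show thesis using that by blast
qed

end

context lf_distrib_lattice
begin

text \<open>Elements are finite ideals of points, which \<open>\<phi>\<close> carries to finite
  ideals of cells, that is, to diagrams; inclusion of diagrams is the pointwise order of row
  lengths.\<close>

lemma lattice_of_shapes:
  assumes iso: "order_iso \<phi> (points :: 'a set) (\<le>) (cells R s) (\<le>)"
    and R: "\<And>i. Suc i \<in> R \<Longrightarrow> i \<in> R" and s: "\<And>i. s i \<le> s (Suc i)"
  shows "\<exists>\<psi>. order_iso \<psi> (UNIV :: 'a set) (\<le>) (shapes R s) (\<le>)"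
proof -
  have bij: "bij_betw \<phi> (points :: 'a set) (cells R s)" and
    ord: "\<And>p q. p \<in> points \<Longrightarrow> q \<in> points \<Longrightarrow> p \<le> q \<longleftrightarrow> \<phi> p \<le> \<phi> q"
    using iso by (auto simp: order_iso_def)
  have inj: "inj_on \<phi> (points :: 'a set)" and im: "\<phi> ` (points :: 'a set) = cells R s"
    using bij by (auto simp: bij_betw_def)
  have img: "fin_ideal (cells R s) (\<phi> ` points_below x)" for x :: 'a
    unfolding fin_ideal_def
  proof (intro conjI ballI impI)
    show "finite (\<phi> ` points_below x)" using finite_points_below by simp
    show "\<phi> ` points_below x \<subseteq> cells R s" using im by (auto simp: points_below_def)
    fix c d assume c: "c \<in> \<phi> ` points_below x" and d: "d \<in> cells R s" "d \<le> c"
    obtain p where p: "p \<in> points" "p \<le> x" "c = \<phi> p" using c by (auto simp: points_below_def)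
    obtain q where q: "q \<in> points" "d = \<phi> q" using d(1) im by blast
    have "q \<le> p" using ord[OF q(1) p(1)] d(2) p q by simp
    then show "d \<in> \<phi> ` points_below x" using p q by (auto simp: points_below_def intro: order.trans)
  qed
  have "\<forall>x :: 'a. \<exists>f. f \<in> shapes R s \<and> \<phi> ` points_below x = diagram s f"
    using ideal_diagram[of R s, OF R s img] by metis
  then obtain \<psi> where psi: "\<And>x :: 'a. \<psi> x \<in> shapes R s" "\<And>x :: 'a. \<phi> ` points_below x = diagram s (\<psi> x)"
    by metis
  have le: "x \<le> y \<longleftrightarrow> \<psi> x \<le> \<psi> y" for x y :: 'a
  proof -
    have "x \<le> y \<longleftrightarrow> \<phi> ` points_below x \<subseteq> \<phi> ` points_below y"
      unfolding points_below_mono_iff[symmetric]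
    proof
      assume sub: "\<phi> ` points_below x \<subseteq> \<phi> ` points_below y"
      have pts: "points_below x \<subseteq> points" "points_below y \<subseteq> points" by (auto simp: points_below_def)
      show "points_below x \<subseteq> points_below y"
        using sub pts inj_on_image_mem_iff[OF inj _ pts(2)] by blast
    qed (rule image_mono)
    then show ?thesis unfolding psi(2) diagram_subset_iff .
  qed
  have "\<exists>x :: 'a. \<psi> x = f" if f: "f \<in> shapes R s" for f
  proof -
    have D: "fin_ideal (cells R s) (diagram s f)" by (rule diagram_ideal[OF R s f])
    define I where "I = {p \<in> points :: 'a set. \<phi> p \<in> diagram s f}"
    have "diagram s f \<subseteq> \<phi> ` (points :: 'a set)" "finite (diagram s f)"
      using D unfolding im fin_ideal_def by blast+
    moreover from this(1) have imI: "\<phi> ` I = diagram s f" unfolding I_def by blast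
    moreover have "inj_on \<phi> I" by (rule inj_on_subset[OF inj]) (auto simp: I_def)
    ultimately have "finite I" using finite_imageD by metis
    moreover have "q \<in> I" if "p \<in> I" "q \<in> points" "q \<le> p" for p q
    proof -
      have "\<phi> q \<le> \<phi> p" "\<phi> q \<in> cells R s" using that ord im unfolding I_def by blast+
      then show ?thesis using that D unfolding I_def fin_ideal_def by blast
    qed
    ultimately have "fin_ideal points I" unfolding fin_ideal_def I_def by blast
    then obtain x :: 'a where "points_below x = I" using ex_points_below by blast
    then have "diagram s (\<psi> x) = diagram s f" using psi(2)[of x] imI by simp
    then have "\<psi> x = f" using diagram_subset_iff[of s] by (metis order_antisym order_refl)
    then show ?thesis by blast
  qed
  moreover have "inj \<psi>"
  proof (rule injI)
    fix x y assume "\<psi> x = \<psi> y"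
    then have "x \<le> y" "y \<le> x" unfolding le[of x y] le[of y x] by auto
    then show "x = y" by (rule order_antisym)
  qed
  ultimately have "bij_betw \<psi> UNIV (shapes R s)" using psi(1) by (auto simp: bij_betw_def)
  then show ?thesis unfolding order_iso_def using le by blast
qed

end

section \<open>The model regions as cells and the partition lattices as shapes\<close>

lemma antimono_Suc: "antimono (f :: nat \<Rightarrow> nat) \<longleftrightarrow> (\<forall>i. f (Suc i) \<le> f i)"
  by (auto simp: antimono_iff_le_Suc)

lemma quadrant_cells: "quadrant = cells UNIV (\<lambda>i. 0)"
  by (auto simp: quadrant_def cells_def nonneg_int_cases intro: nonneg_eq_int)

lemma octant_cells: "octant = cells UNIV int"
proof -
  have "(u, v) \<in> octant \<longleftrightarrow> (u, v) \<in> cells UNIV int" for u v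
    unfolding octant_def cells_def by (auto intro: nonneg_eq_int)
  then show ?thesis by auto
qed

lemma strip_cells: "strip k = cells {..<k} (\<lambda>i. 0)"
proof -
  have "(u, v) \<in> strip k \<longleftrightarrow> (u, v) \<in> cells {..<k} (\<lambda>i. 0)" for u v
    unfolding strip_def cells_def by (auto intro: bexI[of _ "nat v"])
  then show ?thesis by auto
qed

lemma partitions_shapes: "partitions = shapes UNIV (\<lambda>i. 0)"
  unfolding partitions_def shapes_def antimono_Suc by (force intro: le0)

text \<open>With row starts \<open>s i = int i\<close>, the condition on row ends says that a
  nonzero part is strictly smaller than the part before it.\<close>

lemma strict_partitions_shapes: "strict_partitions = shapes UNIV int"
proof -
  have "f \<in> strict_partitions \<longleftrightarrow> f \<in> shapes UNIV int" for f
  proof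
    assume "f \<in> strict_partitions"
    then have f: "finite {i. f i \<noteq> 0}" "antimono f" "\<And>i j. i < j \<Longrightarrow> f i \<noteq> 0 \<Longrightarrow> f j < f i"
      by (auto simp: strict_partitions_def partitions_def)
    have "int (Suc i) + int (f (Suc i)) \<le> int i + int (f i)" if "f (Suc i) \<noteq> 0" for i
    proof -
      have "f i \<noteq> 0" using that f(2) unfolding antimono_Suc by (metis le_zero_eq)
      then show ?thesis using f(3)[of i "Suc i"] by simp
    qed
    then show "f \<in> shapes UNIV int" using f(1) by (simp add: shapes_def)
  next
    assume "f \<in> shapes UNIV int"
    then have f1: "finite {i. f i \<noteq> 0}"
      and f2: "\<And>i. f (Suc i) \<noteq> 0 \<Longrightarrow> int (Suc i) + int (f (Suc i)) \<le> int i + int (f i)"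
      unfolding shapes_def by blast+
    have f: "finite {i. f i \<noteq> 0}" "f (Suc i) \<noteq> 0 \<Longrightarrow> f (Suc i) < f i" for i
      using f1 f2[of i] by simp_all
    then have "f (Suc i) \<le> f i" for i by (cases "f (Suc i) = 0") (auto intro: less_imp_le)
    then have am: "antimono f" by (simp add: antimono_Suc)
    have "f j < f i" if "i < j" "f i \<noteq> 0" for i j
    proof -
      have "f (Suc i) < f i" using f(2)[of i] that by (cases "f (Suc i) = 0") auto
      moreover have "f j \<le> f (Suc i)" using am that by (simp add: antimono_def)
      ultimately show ?thesis by simp
    qed
    then show "f \<in> strict_partitions" using f(1) am by (simp add: strict_partitions_def partitions_def)
  qed
  then show ?thesis by blast
qed

text \<open>The support of a weakly decreasing sequence is an initial segment, so having at most
  \<open>k\<close> nonzero parts means vanishing from index \<open>k\<close> on.\<close>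

lemma partitions_at_most_shapes: "partitions_at_most k = shapes {..<k} (\<lambda>i. 0)"
proof -
  have "card {i. f i \<noteq> 0} \<le> k \<longleftrightarrow> (\<forall>i. f i \<noteq> 0 \<longrightarrow> i < k)"
    if f: "antimono f" "finite {i. f i \<noteq> 0}" for f :: "nat \<Rightarrow> nat"
  proof
    assume c: "card {i. f i \<noteq> 0} \<le> k"
    show "\<forall>i. f i \<noteq> 0 \<longrightarrow> i < k"
    proof (intro allI impI)
      fix i assume i: "f i \<noteq> 0"
      have "f i \<le> f j" if "j \<le> i" for j using f(1) that by (simp add: antimono_def)
      then have "{..i} \<subseteq> {i. f i \<noteq> 0}" using i by fastforce
      then have "card {..i} \<le> k" using card_mono[OF f(2)] c by (meson order.trans)
      then show "i < k" by simp
    qed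
  next
    assume "\<forall>i. f i \<noteq> 0 \<longrightarrow> i < k"
    then have "{i. f i \<noteq> 0} \<subseteq> {..<k}" by auto
    then show "card {i. f i \<noteq> 0} \<le> k" using card_mono[of "{..<k}"] by fastforce
  qed
  moreover have "f \<in> shapes {..<k} (\<lambda>i. 0) \<longleftrightarrow> f \<in> partitions \<and> (\<forall>i. f i \<noteq> 0 \<longrightarrow> i < k)" for f
    unfolding partitions_shapes by (auto simp: shapes_def)
  ultimately show ?thesis by (auto simp: partitions_at_most_def partitions_def)
qed

theorem theorem7p1:
  fixes w :: "'a::{distrib_lattice, bounded_lattice_bot} \<Rightarrow> 'a \<Rightarrow> int"
    and r :: int
  assumes fomin: "fomin_lattice r w"
    and ucm: "unique_cover_modular (points :: 'a set)"
    and w_pos: "\<And>x y. x \<lessdot> y \<Longrightarrow> w x y > 0"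
    and r_pos: "r > 0"
    and indecomposable: "\<not> product_decomposable TYPE('a)"
  shows "\<exists>wP. given_by_points w wP \<and>
    ( (\<exists>\<phi>. order_iso \<phi> (points :: 'a set) (\<le>) quadrant (\<le>) \<and>
           (\<forall>p\<in>points. wP p = r)) \<and>
      (\<exists>\<psi>. order_iso \<psi> (UNIV :: 'a set) (\<le>) partitions (\<le>))
    \<or> (\<exists>\<phi>. order_iso \<phi> (points :: 'a set) (\<le>) octant (\<le>) \<and>
           (\<forall>p\<in>points. wP p = (if fst (\<phi> p) = snd (\<phi> p) then r else 2 * r))) \<and>
      (\<exists>\<psi>. order_iso \<psi> (UNIV :: 'a set) (\<le>) strict_partitions (\<le>))
    \<or> (\<exists>k\<ge>1.
        (\<exists>\<phi>. order_iso \<phi> (points :: 'a set) (\<le>) (strip k) (\<le>) \<and>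
             (\<forall>p\<in>points. rat_of_int (wP p) =
                rat_of_int r / rat_of_nat k * rat_of_int (int k + fst (\<phi> p) - snd (\<phi> p)))) \<and>
        (\<exists>\<psi>. order_iso \<psi> (UNIV :: 'a set) (\<le>) (partitions_at_most k) (\<le>))))"
proof -
  interpret fomin_lattice r w by fact
  have distrib: "distrib_fomin_lattice r w"
    by unfold_locales (rule locally_finite)
  interpret distrib_fomin_lattice r w by fact
  interpret P: differential_poset "points :: 'a set" wP r
    by (rule differential_poset_points[OF distrib ucm w_pos r_pos indecomposable])
  from P.classification show ?thesis
  proof (elim disjE exE conjE)
    fix \<phi> assume phi: "order_iso \<phi> (points :: 'a set) (\<le>) quadrant (\<le>)" "\<forall>p\<in>points. wP p = r"
    have "\<exists>\<psi>. order_iso \<psi> (UNIV :: 'a set) (\<le>) partitions (\<le>)"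
      unfolding partitions_shapes
      by (rule lattice_of_shapes[OF phi(1)[unfolded quadrant_cells]]) simp_all
    with phi given_by_points show ?thesis by blast
  next
    fix \<phi> assume phi: "order_iso \<phi> (points :: 'a set) (\<le>) octant (\<le>)"
      "\<forall>p\<in>points. wP p = (if fst (\<phi> p) = snd (\<phi> p) then r else 2 * r)"
    have "\<exists>\<psi>. order_iso \<psi> (UNIV :: 'a set) (\<le>) strict_partitions (\<le>)"
      unfolding strict_partitions_shapes
      by (rule lattice_of_shapes[OF phi(1)[unfolded octant_cells]]) simp_all
    with phi given_by_points show ?thesis by blast
  next
    fix k \<phi> assume k: "1 \<le> k" and phi: "order_iso \<phi> (points :: 'a set) (\<le>) (strip k) (\<le>)"
      "\<forall>p\<in>points. int k * wP p = r * (int k + fst (\<phi> p) - snd (\<phi> p))"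
    have "\<exists>\<psi>. order_iso \<psi> (UNIV :: 'a set) (\<le>) (partitions_at_most k) (\<le>)"
      unfolding partitions_at_most_shapes
      by (rule lattice_of_shapes[OF phi(1)[unfolded strip_cells]]) simp_all
    \<comment> \<open>Division by \<open>k \<ge> 1\<close> turns the integral form of the weights
      into the fraction.\<close>
    moreover have "\<forall>p\<in>points. rat_of_int (wP p) =
        rat_of_int r / rat_of_nat k * rat_of_int (int k + fst (\<phi> p) - snd (\<phi> p))"
    proof
      fix p :: 'a assume "p \<in> points"
      then have "rat_of_int (int k * wP p) = rat_of_int (r * (int k + fst (\<phi> p) - snd (\<phi> p)))"
        using phi(2) by simp
      then have "rat_of_nat k * rat_of_int (wP p) = rat_of_int r * rat_of_int (int k + fst (\<phi> p) - snd (\<phi> p))"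
        by simp
      then show "rat_of_int (wP p) =
          rat_of_int r / rat_of_nat k * rat_of_int (int k + fst (\<phi> p) - snd (\<phi> p))"
        using k by (simp add: field_simps)
    qed
    ultimately show ?thesis using k phi(1) given_by_points by blast
  qed
qed

end
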